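(* Suppose $\mathcal K$ is a transitive projective Fraïssé class such that the image of ${\rm Aut}(\mathbb K)$ under the canonical homomorphism ${\rm pr}$ is dense in ${\rm Homeo}(K)$. Let $n\in\mathbb N$. (i) If $\mathcal K^{\times n}_{\rm p}$ has the approximate JPP, then for every non-empty open $U\subseteq{\rm Homeo}(K)^n$, the set $\{\bar\gamma\in{\rm Aut}(\mathbb K)^n:\bar\gamma^{{\rm Aut}(\mathbb K)}\cap U\neq\emptyset\}$ is dense in ${\rm Homeo}(K)^n$. (ii) If $\mathcal K^{\times n}_{\rm p}$ has the half-approximate JPP, then for every non-empty open $U\subseteq{\rm Homeo}(K)^n$, the set $\{\bar\gamma\in{\rm Aut}(\mathbb K)^n:\bar\gamma^{{\rm Aut}(\mathbb K)}\cap U\neq\emptyset\}$ is dense in ${\rm Aut}(\mathbb K)^n$. (iii) If $\mathcal K^{\times n}_{\rm p}$ has the JPP, then for every non-empty open $U\subseteq{\rm Aut}(\mathbb K)^n$, the set $\{\bar\gamma\in{\rm Aut}(\mathbb K)^n:\bar\gamma^{{\rm Aut}(\mathbb K)}\cap U\neq\emptyset\}$ is dense in ${\rm Aut}(\mathbb K)^n$.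
   Context: Reflexive graph: set with reflexive symmetric relation $R$; strong homomorphism: $R$-preserving map such that every $R$-related pair in the target is the image of an $R$-related pair. $\mathcal K$: countable category of finite reflexive graphs with morphism sets ${\rm Epi}(A,B)$ of strong homomorphisms, satisfying (o) [if $f\in{\rm Epi}(A,B)$, $h\in{\rm Epi}(A,C)$, $g:B\to C$, $h=g\circ f$, then $g\in{\rm Epi}(B,C)$], joint projection, projective amalgamation. $\mathbb K=\varprojlim(A_n,\pi_n)$ for a generic sequence ($A_n\in\mathcal K$, $\pi_n\in{\rm Epi}(A_{n+1},A_n)$, every $A\in\mathcal K$ receives a morphism from some $A_m$, every $f\in{\rm Epi}(A,A_m)$ satisfies $f\circ g=\pi_m\circ\cdots\circ\pi_{n-1}$ for some $n>m$, $g\in{\rm Epi}(A_n,A)$), ${\rm Epi}(\mathbb K,A)=\{f\circ\pi^\infty_n:f\in{\rm Epi}(A_n,A)\}$. $xR^{\mathbb K}y$ iff $\varphi(x)R\varphi(y)$ for all such $\varphi$; transitive means $R^{\mathbb K}$ is transitive; $K=\mathbb K/R^{\mathbb K}$ with quotient map ${\rm pr}$. ${\rm Aut}(\mathbb K)$: homeomorphisms $\sigma$ of $\mathbb K$ with $\varphi\circ\sigma,\varphi\circ\sigma^{-1}\in{\rm Epi}(\mathbb K,A)$ for all $\varphi\in{\rm Epi}(\mathbb K,A)$, topologized by uniform convergence on $\mathbb K$; ${\rm pr}:{\rm Aut}(\mathbb K)\to{\rm Homeo}(K)$, ${\rm pr}(\sigma)({\rm pr}(x))={\rm pr}(\sigma(x))$,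 is a continuous homomorphism, and ${\rm Homeo}(K)$ has the uniform convergence topology; elements of ${\rm Aut}(\mathbb K)$ are regarded as elements of ${\rm Homeo}(K)$ via ${\rm pr}$. For $\bar\gamma=(\gamma_j)_{j<n}\in{\rm Aut}(\mathbb K)^n$, $\bar\gamma^{{\rm Aut}(\mathbb K)}=\{(g\gamma_jg^{-1})_{j<n}:g\in{\rm Aut}(\mathbb K)\}$. $\mathcal K^{\times n}_{\rm p}$: objects are tuples $(A,B,\bar f,\bar g)=(A,B,f_0,\dots,f_{n-1},g_0,\dots,g_{n-1})$ with $A,B\in\mathcal K$ and $f_i,g_i\in{\rm Epi}(A,B)$. A map $\alpha\in{\rm Epi}(A,A')$ is an epimorphism (resp. approximate epimorphism) from $(A,B,\bar f,\bar g)$ to $(A',B',\bar f',\bar g')$ if for every $i<n$ and all $a_0,a_1\in A$ with $f_i(a_0)=g_i(a_1)$ we have $f'_i(\alpha(a_0))=g'_i(\alpha(a_1))$ (resp. $f'_i(\alpha(a_0))\,R\,g'_i(\alpha(a_1))$). $\mathcal K^{\times n}_{\rm p}$ has the JPP (resp. half-approximate JPP, approximate JPP) if for all objects $X=(A,B,\bar f,\bar g)$, $X'=(A',B',\bar f',\bar g')$ there are an object $X^+=(A^+,B^+,\bar f^+,\bar g^+)$ and $\alpha:X^+\to X$, $\alpha':X^+\to X'$ such that both are epimorphisms (resp. $\alpha$ is an epimorphism and $\alpha'$ an approximate epimorphism; resp. both are approximate epimorphisms). *)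

theory Defs
  imports "HOL-Analysis.Analysis"
begin

section \<open>Finite reflexive graphs and projective Fraisse classes\<close>

text \<open>
  Maps between given sets are always taken extensional (equal to \<open>undefined\<close> off their
  domain), so that equality of maps is equality of HOL functions, and composition is
  \<^const>\<open>compose\<close>.
\<close>

record 'v rgraph =
  verts :: "'v set"
  rel :: "('v \<times> 'v) set"

definition reflexive_graph :: "'v rgraph \<Rightarrow> bool" where
  "reflexive_graph G \<longleftrightarrow>
     rel G \<subseteq> verts G \<times> verts G \<and> refl_on (verts G) (rel G) \<and> sym (rel G)"

definition strong_homs :: "'v rgraph \<Rightarrow> 'v rgraph \<Rightarrow> ('v \<Rightarrow> 'v) set" where
  "strong_homs G H =
     {f \<in> verts G \<rightarrow>\<^sub>E verts H.
        (\<forall>x y. (x, y) \<in> rel G \<longrightarrow> (f x, f y) \<in> rel H) \<and>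
        (\<forall>u v. (u, v) \<in> rel H \<longrightarrow> (\<exists>x y. (x, y) \<in> rel G \<and> f x = u \<and> f y = v))}"

record 'v graph_class =
  Obj :: "'v rgraph set"
  Epi :: "'v rgraph \<Rightarrow> 'v rgraph \<Rightarrow> ('v \<Rightarrow> 'v) set"

definition graph_category :: "'v graph_class \<Rightarrow> bool" where
  "graph_category C \<longleftrightarrow>
     (\<forall>A \<in> Obj C. reflexive_graph A \<and> finite (verts A)) \<and>
     (\<forall>A \<in> Obj C. \<forall>B \<in> Obj C. Epi C A B \<subseteq> strong_homs A B) \<and>
     (\<forall>A \<in> Obj C. (\<lambda>x\<in>verts A. x) \<in> Epi C A A) \<and>
     (\<forall>A \<in> Obj C. \<forall>B \<in> Obj C. \<forall>D \<in> Obj C. \<forall>f \<in> Epi C A B. \<forall>g \<in> Epi C B D.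
        compose (verts A) g f \<in> Epi C A D)"

text \<open>Hom-sets between finite graphs are finite, so countability only concerns the objects.\<close>

definition projective_fraisse_class :: "'v graph_class \<Rightarrow> bool" where
  "projective_fraisse_class C \<longleftrightarrow>
     graph_category C \<and> countable (Obj C) \<and>
     \<comment> \<open>right factors of morphisms through morphisms are morphisms\<close>
     (\<forall>A \<in> Obj C. \<forall>B \<in> Obj C. \<forall>D \<in> Obj C.
        \<forall>f \<in> Epi C A B. \<forall>h \<in> Epi C A D. \<forall>g \<in> verts B \<rightarrow>\<^sub>E verts D.
          h = compose (verts A) g f \<longrightarrow> g \<in> Epi C B D) \<and>
     \<comment> \<open>joint projection\<close>
     (\<forall>A \<in> Obj C. \<forall>B \<in> Obj C. \<exists>D \<in> Obj C. Epi C D A \<noteq> {} \<and> Epi C D B \<noteq> {}) \<and>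
     \<comment> \<open>projective amalgamation\<close>
     (\<forall>A \<in> Obj C. \<forall>B \<in> Obj C. \<forall>B' \<in> Obj C. \<forall>f \<in> Epi C B A. \<forall>f' \<in> Epi C B' A.
        \<exists>D \<in> Obj C. \<exists>g \<in> Epi C D B. \<exists>g' \<in> Epi C D B'.
          compose (verts D) f g = compose (verts D) f' g')"


section \<open>Generic sequences and the limit\<close>

text \<open>For \<open>m \<le> n\<close>, \<open>bonding A p m n\<close> is \<open>p m \<circ> \<dots> \<circ> p (n - 1)\<close> on \<open>A n\<close>; for \<open>n < m\<close> its
  value is irrelevant.\<close>

primrec bonding :: "(nat \<Rightarrow> 'v rgraph) \<Rightarrow> (nat \<Rightarrow> 'v \<Rightarrow> 'v) \<Rightarrow> nat \<Rightarrow> nat \<Rightarrow> 'v \<Rightarrow> 'v" where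
  "bonding A p m 0 = (\<lambda>x\<in>verts (A 0). x)"
| "bonding A p m (Suc n) =
     (if m \<le> n then compose (verts (A (Suc n))) (bonding A p m n) (p n)
      else (\<lambda>x\<in>verts (A (Suc n)). x))"

definition generic_sequence ::
  "'v graph_class \<Rightarrow> (nat \<Rightarrow> 'v rgraph) \<Rightarrow> (nat \<Rightarrow> 'v \<Rightarrow> 'v) \<Rightarrow> bool" where
  "generic_sequence C A p \<longleftrightarrow>
     (\<forall>n. A n \<in> Obj C) \<and>
     (\<forall>n. p n \<in> Epi C (A (Suc n)) (A n)) \<and>
     (\<forall>B \<in> Obj C. \<exists>m. Epi C (A m) B \<noteq> {}) \<and>
     (\<forall>m. \<forall>B \<in> Obj C. \<forall>f \<in> Epi C B (A m).
        \<exists>n>m. \<exists>g \<in> Epi C (A n) B. compose (verts (A n)) f g = bonding A p m n)"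

definition limit_points :: "(nat \<Rightarrow> 'v rgraph) \<Rightarrow> (nat \<Rightarrow> 'v \<Rightarrow> 'v) \<Rightarrow> (nat \<Rightarrow> 'v) set" where
  "limit_points A p = {x. \<forall>n. x n \<in> verts (A n) \<and> p n (x (Suc n)) = x n}"

definition limit_space :: "(nat \<Rightarrow> 'v rgraph) \<Rightarrow> (nat \<Rightarrow> 'v \<Rightarrow> 'v) \<Rightarrow> (nat \<Rightarrow> 'v) topology" where
  "limit_space A p =
     subtopology (product_topology (\<lambda>n. discrete_topology (verts (A n))) UNIV) (limit_points A p)"

definition limit_epi ::
  "'v graph_class \<Rightarrow> (nat \<Rightarrow> 'v rgraph) \<Rightarrow> (nat \<Rightarrow> 'v \<Rightarrow> 'v) \<Rightarrow> 'v rgraph \<Rightarrow> ((nat \<Rightarrow> 'v) \<Rightarrow> 'v) set"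
  where
  "limit_epi C A p B = {(\<lambda>x\<in>limit_points A p. f (x n)) | n f. f \<in> Epi C (A n) B}"

definition limit_rel ::
  "'v graph_class \<Rightarrow> (nat \<Rightarrow> 'v rgraph) \<Rightarrow> (nat \<Rightarrow> 'v \<Rightarrow> 'v) \<Rightarrow> ((nat \<Rightarrow> 'v) \<times> (nat \<Rightarrow> 'v)) set"
  where
  "limit_rel C A p =
     {(x, y). x \<in> limit_points A p \<and> y \<in> limit_points A p \<and>
        (\<forall>B \<in> Obj C. \<forall>\<phi> \<in> limit_epi C A p B. (\<phi> x, \<phi> y) \<in> rel B)}"

lemma topspace_limit_space [simp]: "topspace (limit_space A p) = limit_points A p"
  by (auto simp: limit_space_def limit_points_def)


section \<open>Quotient spaces and homeomorphism groups\<close>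

definition quotient_topology :: "'a topology \<Rightarrow> ('a \<times> 'a) set \<Rightarrow> 'a set topology" where
  "quotient_topology X r =
     topology (\<lambda>U. U \<subseteq> topspace X // r \<and> openin X {x \<in> topspace X. r `` {x} \<in> U})"

lemma openin_quotient_topology:
  "openin (quotient_topology X r) U \<longleftrightarrow>
     U \<subseteq> topspace X // r \<and> openin X {x \<in> topspace X. r `` {x} \<in> U}"
proof -
  have "istopology (\<lambda>U. U \<subseteq> topspace X // r \<and> openin X {x \<in> topspace X. r `` {x} \<in> U})"
    unfolding istopology_def
  proof (intro conjI allI impI)
    fix S T
    assume S: "S \<subseteq> topspace X // r \<and> openin X {x \<in> topspace X. r `` {x} \<in> S}"
      and T: "T \<subseteq> topspace X // r \<and> openin X {x \<in> topspace X. r `` {x} \<in> T}"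
    have "{x \<in> topspace X. r `` {x} \<in> S \<inter> T} =
        {x \<in> topspace X. r `` {x} \<in> S} \<inter> {x \<in> topspace X. r `` {x} \<in> T}"
      by auto
    then show "openin X {x \<in> topspace X. r `` {x} \<in> S \<inter> T}"
      using S T by auto
    show "S \<inter> T \<subseteq> topspace X // r" using S by auto
  next
    fix \<K>
    assume K: "\<forall>S\<in>\<K>. S \<subseteq> topspace X // r \<and> openin X {x \<in> topspace X. r `` {x} \<in> S}"
    have "{x \<in> topspace X. r `` {x} \<in> \<Union>\<K>} = (\<Union>S\<in>\<K>. {x \<in> topspace X. r `` {x} \<in> S})"
      by auto
    then show "openin X {x \<in> topspace X. r `` {x} \<in> \<Union>\<K>}"
      using K by auto
    show "\<Union>\<K> \<subseteq> topspace X // r" using K by auto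
  qed
  then show ?thesis by (simp add: quotient_topology_def)
qed

lemma topspace_quotient_topology [simp]: "topspace (quotient_topology X r) = topspace X // r"
proof -
  have "{x \<in> topspace X. r `` {x} \<in> topspace X // r} = topspace X"
    by (auto simp: quotient_def)
  then have "openin (quotient_topology X r) (topspace X // r)"
    by (simp add: openin_quotient_topology)
  then show ?thesis
    by (metis openin_quotient_topology openin_subset openin_topspace subset_antisym)
qed

lemma quotient_map_quotient_topology: "quotient_map X (quotient_topology X r) (\<lambda>x. r `` {x})"
  by (auto simp: quotient_map_def openin_quotient_topology quotient_def)

definition homeos :: "'a topology \<Rightarrow> ('a \<Rightarrow> 'a) set" where
  "homeos X = {f \<in> extensional (topspace X). homeomorphic_map X X f}"

definition map_inv :: "'a set \<Rightarrow> ('a \<Rightarrow> 'a) \<Rightarrow> 'a \<Rightarrow> 'a" where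
  "map_inv S f = restrict (inv_into S f) S"

text \<open>
  Uniform convergence, intended for compact Hausdorff \<open>X\<close>: the unique uniformity compatible with
  the topology of \<open>X\<close> consists of the neighbourhoods of the diagonal. For a compact metrizable
  space this is the topology of the supremum metric, whichever compatible metric is used; see
  lemma \<open>homeo_topology_eq_cfunspace\<close>.
\<close>

definition homeo_topology :: "'a topology \<Rightarrow> ('a \<Rightarrow> 'a) topology" where
  "homeo_topology X = topology (\<lambda>U. U \<subseteq> homeos X \<and>
     (\<forall>f \<in> U. \<exists>W. openin (prod_topology X X) W \<and> (\<forall>x \<in> topspace X. (x, x) \<in> W) \<and>
        {g \<in> homeos X. \<forall>x \<in> topspace X. (f x, g x) \<in> W} \<subseteq> U))"

lemma openin_homeo_topology:
  "openin (homeo_topology X) U \<longleftrightarrow> U \<subseteq> homeos X \<and>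
     (\<forall>f \<in> U. \<exists>W. openin (prod_topology X X) W \<and> (\<forall>x \<in> topspace X. (x, x) \<in> W) \<and>
        {g \<in> homeos X. \<forall>x \<in> topspace X. (f x, g x) \<in> W} \<subseteq> U)" (is "_ \<longleftrightarrow> ?P U")
proof -
  have "istopology ?P"
    unfolding istopology_def
  proof (rule conjI; intro allI impI)
    fix S T
    assume S: "?P S" and T: "?P T"
    show "?P (S \<inter> T)"
    proof (intro conjI ballI)
      show "S \<inter> T \<subseteq> homeos X" using S by auto
      fix f assume f: "f \<in> S \<inter> T"
      obtain V where V: "openin (prod_topology X X) V" "\<forall>x \<in> topspace X. (x, x) \<in> V"
        "{g \<in> homeos X. \<forall>x \<in> topspace X. (f x, g x) \<in> V} \<subseteq> S"
        using S f by blast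
      obtain W where W: "openin (prod_topology X X) W" "\<forall>x \<in> topspace X. (x, x) \<in> W"
        "{g \<in> homeos X. \<forall>x \<in> topspace X. (f x, g x) \<in> W} \<subseteq> T"
        using T f by blast
      show "\<exists>W. openin (prod_topology X X) W \<and> (\<forall>x \<in> topspace X. (x, x) \<in> W) \<and>
          {g \<in> homeos X. \<forall>x \<in> topspace X. (f x, g x) \<in> W} \<subseteq> S \<inter> T"
        using V W by (intro exI[of _ "V \<inter> W"]) auto
    qed
  next
    fix \<K>
    assume K: "\<forall>S\<in>\<K>. ?P S"
    show "?P (\<Union>\<K>)"
    proof (intro conjI ballI)
      show "\<Union>\<K> \<subseteq> homeos X" using K by auto
      fix f assume "f \<in> \<Union>\<K>"
      then obtain S where S: "S \<in> \<K>" "f \<in> S" by blast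
      then obtain V where V: "openin (prod_topology X X) V" "\<forall>x \<in> topspace X. (x, x) \<in> V"
        "{g \<in> homeos X. \<forall>x \<in> topspace X. (f x, g x) \<in> V} \<subseteq> S"
        using K by meson
      then show "\<exists>W. openin (prod_topology X X) W \<and> (\<forall>x \<in> topspace X. (x, x) \<in> W) \<and>
          {g \<in> homeos X. \<forall>x \<in> topspace X. (f x, g x) \<in> W} \<subseteq> \<Union>\<K>"
        using S(1) by (intro exI[of _ V]) blast
    qed
  qed
  then show ?thesis by (simp add: homeo_topology_def)
qed

lemma topspace_homeo_topology [simp]: "topspace (homeo_topology X) = homeos X"
proof -
  have "openin (prod_topology X X) (topspace (prod_topology X X))"
    by (rule openin_topspace)
  then have "openin (homeo_topology X) (homeos X)"
    unfolding openin_homeo_topology by auto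
  then show ?thesis
    by (metis openin_homeo_topology openin_subset openin_topspace subset_antisym)
qed

lemma openin_subtopology_mtopology_of:
  assumes H: "H \<subseteq> mspace m"
  shows "openin (subtopology (mtopology_of m) H) U \<longleftrightarrow>
    U \<subseteq> H \<and> (\<forall>f\<in>U. \<exists>r>0. {g \<in> H. mdist m f g < r} \<subseteq> U)"
proof -
  interpret F: Metric_space "mspace m" "mdist m"
    by (rule Metric_space_mspace_mdist)
  show ?thesis
  proof
    assume "openin (subtopology (mtopology_of m) H) U"
    then obtain T where T: "openin F.mtopology T" "U = T \<inter> H"
      by (auto simp: openin_subtopology mtopology_of_def)
    have "\<exists>r>0. {g \<in> H. mdist m f g < r} \<subseteq> U" if f: "f \<in> U" for f
    proof -
      obtain r where r: "r > 0" "F.mball f r \<subseteq> T"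
        using T f by (auto simp: F.openin_mtopology)
      have "f \<in> mspace m" using f T H by auto
      then have "{g \<in> H. mdist m f g < r} \<subseteq> F.mball f r"
        using H by auto
      with r T show ?thesis by blast
    qed
    then show "U \<subseteq> H \<and> (\<forall>f\<in>U. \<exists>r>0. {g \<in> H. mdist m f g < r} \<subseteq> U)"
      using T by blast
  next
    assume U: "U \<subseteq> H \<and> (\<forall>f\<in>U. \<exists>r>0. {g \<in> H. mdist m f g < r} \<subseteq> U)"
    then obtain r where r: "\<And>f. f \<in> U \<Longrightarrow> r f > 0 \<and> {g \<in> H. mdist m f g < r f} \<subseteq> U"
      by metis
    have "openin F.mtopology (\<Union>f\<in>U. F.mball f (r f))"
      by auto
    moreover have "U = (\<Union>f\<in>U. F.mball f (r f)) \<inter> H"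
    proof
      show "U \<subseteq> (\<Union>f\<in>U. F.mball f (r f)) \<inter> H"
      proof
        fix f assume f: "f \<in> U"
        then have "f \<in> H" "f \<in> F.mball f (r f)" using U r H by auto
        with f show "f \<in> (\<Union>f\<in>U. F.mball f (r f)) \<inter> H" by blast
      qed
      show "(\<Union>f\<in>U. F.mball f (r f)) \<inter> H \<subseteq> U"
      proof
        fix g assume "g \<in> (\<Union>f\<in>U. F.mball f (r f)) \<inter> H"
        then obtain f where "f \<in> U" "mdist m f g < r f" "g \<in> H" by auto
        then show "g \<in> U" using r[of f] by blast
      qed
    qed
    ultimately show "openin (subtopology (mtopology_of m) H) U"
      unfolding openin_subtopology mtopology_of_def by blast
  qed
qed

lemma homeo_topology_eq_cfunspace:
  assumes "compact_space X" and X: "X = mtopology_of m"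
  shows "homeo_topology X = subtopology (mtopology_of (cfunspace X m)) (homeos X)"
proof -
  interpret M: Metric_space "mspace m" "mdist m"
    by (rule Metric_space_mspace_mdist)
  let ?F = "cfunspace X m"
  have top: "topspace X = mspace m" by (simp add: X)
  have Xt: "X = M.mtopology" by (simp add: X mtopology_of_def)
  have cpt: "compactin M.mtopology (mspace m)"
    using assms(1) by (simp add: Xt compact_space_def)
  have bdd: "M.mbounded S" if "S \<subseteq> mspace m" for S
    using M.compactin_imp_mbounded[OF cpt] M.mbounded_subset that by blast
  have homeo_sub: "homeos X \<subseteq> mspace ?F"
  proof
    fix f assume "f \<in> homeos X"
    then have f: "f \<in> extensional (mspace m)" "homeomorphic_map X X f"
      by (auto simp: homeos_def top)
    then have "continuous_map X X f"
      by (simp add: homeomorphic_imp_continuous_map)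
    moreover have "f ` mspace m = mspace m"
      using homeomorphic_imp_surjective_map[OF f(2)] by (simp add: top)
    ultimately show "f \<in> mspace ?F"
      using f bdd[of "mspace m"] by (auto simp: cfunspace_def M.fspace_def top X[symmetric])
  qed
  have sub: "mspace ?F \<subseteq> mspace (funspace (topspace X) m)"
    by (auto simp: cfunspace_def)
  note ball = openin_subtopology_mtopology_of[OF homeo_sub]
  have im: "f x \<in> mspace m" if "f \<in> homeos X" "x \<in> mspace m" for f x
  proof -
    have "f \<in> mspace (funspace (topspace X) m)" using that(1) homeo_sub sub by blast
    then show ?thesis using that(2) funspace_imp_welldefined top by metis
  qed
  show ?thesis
  proof (subst topology_eq, intro allI)
    fix U
    show "openin (homeo_topology X) U \<longleftrightarrow>
      openin (subtopology (mtopology_of ?F) (homeos X)) U"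
      unfolding ball openin_homeo_topology
    proof (intro conj_cong refl ball_cong)
      fix f assume "U \<subseteq> homeos X" "f \<in> U"
      then have f: "f \<in> homeos X" by auto
      show "(\<exists>W. openin (prod_topology X X) W \<and> (\<forall>x \<in> topspace X. (x, x) \<in> W) \<and>
          {g \<in> homeos X. \<forall>x \<in> topspace X. (f x, g x) \<in> W} \<subseteq> U) \<longleftrightarrow>
        (\<exists>r>0. {g \<in> homeos X. mdist ?F f g < r} \<subseteq> U)"
      proof
        assume "\<exists>W. openin (prod_topology X X) W \<and> (\<forall>x \<in> topspace X. (x, x) \<in> W) \<and>
          {g \<in> homeos X. \<forall>x \<in> topspace X. (f x, g x) \<in> W} \<subseteq> U"
        then obtain W where W: "openin (prod_topology X X) W" "\<forall>x \<in> topspace X. (x, x) \<in> W"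
          "{g \<in> homeos X. \<forall>x \<in> topspace X. (f x, g x) \<in> W} \<subseteq> U"
          by blast
        let ?C = "{V. openin X V \<and> V \<times> V \<subseteq> W}"
        have cover: "mspace m \<subseteq> \<Union>?C"
        proof
          fix x assume "x \<in> mspace m"
          then have "(x, x) \<in> W" using W top by auto
          from W(1)[unfolded openin_prod_topology_alt, rule_format, OF this]
          obtain S T where ST: "openin X S" "openin X T" "x \<in> S" "x \<in> T" "S \<times> T \<subseteq> W"
            by (elim exE conjE)
          have "(S \<inter> T) \<times> (S \<inter> T) \<subseteq> W" using ST(5) by auto
          then have "S \<inter> T \<in> ?C" "x \<in> S \<inter> T" using ST by auto
          then show "x \<in> \<Union>?C" by blast
        qed
        have "\<And>V. V \<in> ?C \<Longrightarrow> openin M.mtopology V"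
          using Xt by (metis (no_types, lifting) mem_Collect_eq)
        from M.lebesgue_number[OF cpt cover, OF this]
        obtain r where r: "r > 0" "\<forall>x\<in>mspace m. \<exists>V\<in>?C. M.mball x r \<subseteq> V"
          by fast
        have "g \<in> U" if g: "g \<in> homeos X" "mdist ?F f g < r" for g
        proof -
          have "(f x, g x) \<in> W" if x: "x \<in> mspace m" for x
          proof -
            have "mdist m (f x) (g x) \<le> mdist ?F f g"
              using mdist_cfunspace_imp_mdist_le [OF subsetD[OF homeo_sub f]
                  subsetD[OF homeo_sub g(1)] order_refl] x by (simp add: top)
            then have "mdist m (f x) (g x) < r" using g(2) by linarith
            then have "g x \<in> M.mball (f x) r" "f x \<in> M.mball (f x) r"
              using im[OF f x] im[OF g(1) x] r(1) by simp_all
            moreover obtain V where "V \<times> V \<subseteq> W" "M.mball (f x) r \<subseteq> V"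
              using r(2) im[OF f x] by blast
            ultimately show ?thesis by blast
          qed
          then show ?thesis using subsetD[OF W(3)] g(1) by (simp add: top)
        qed
        then show "\<exists>r>0. {g \<in> homeos X. mdist ?F f g < r} \<subseteq> U" using r by blast
      next
        assume "\<exists>r>0. {g \<in> homeos X. mdist ?F f g < r} \<subseteq> U"
        then obtain r where r: "r > 0" "{g \<in> homeos X. mdist ?F f g < r} \<subseteq> U" by blast
        let ?W = "\<Union>x\<in>mspace m. M.mball x (r/4) \<times> M.mball x (r/4)"
        have W_dist: "mdist m x y < r/2" if "(x, y) \<in> ?W" for x y
        proof -
          obtain z where z: "x \<in> M.mball z (r/4)" "y \<in> M.mball z (r/4)"
            using \<open>(x, y) \<in> ?W\<close> by blast
          then have "mdist m x y \<le> mdist m z x + mdist m z y"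
            using M.triangle''[of x z y] by simp
          with z show ?thesis by simp
        qed
        have "openin (prod_topology X X) ?W"
        proof (rule openin_Union, clarify)
          fix x
          have "openin X (M.mball x (r/4))"
            unfolding Xt by (rule M.openin_mball)
          then show "openin (prod_topology X X) (M.mball x (r/4) \<times> M.mball x (r/4))"
            by (simp add: openin_prod_Times_iff)
        qed
        moreover have "\<forall>x \<in> topspace X. (x, x) \<in> ?W"
        proof
          fix x assume "x \<in> topspace X"
          then have "x \<in> mspace m" "x \<in> M.mball x (r/4)" using r(1) by (simp_all add: top)
          then show "(x, x) \<in> ?W" by blast
        qed
        moreover have "g \<in> U" if g: "g \<in> homeos X" "\<forall>x \<in> topspace X. (f x, g x) \<in> ?W" for g
        proof -
          have "mdist ?F f g \<le> r/2"
          proof (rule mdist_cfunspace_le)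
            show "0 \<le> r/2" using r(1) by simp
            show "mdist m (f x) (g x) \<le> r/2" if "x \<in> topspace X" for x
              using W_dist g(2) that by (meson less_imp_le)
          qed
          then have "mdist ?F f g < r" using r(1) by simp
          then show ?thesis using g(1) r(2) by blast
        qed
        ultimately show "\<exists>W. openin (prod_topology X X) W \<and> (\<forall>x \<in> topspace X. (x, x) \<in> W) \<and>
          {g \<in> homeos X. \<forall>x \<in> topspace X. (f x, g x) \<in> W} \<subseteq> U"
          by (intro exI[of _ ?W]) blast
      qed
    qed
  qed
qed


section \<open>Automorphisms of the limit and the canonical homomorphism\<close>

definition aut ::
  "'v graph_class \<Rightarrow> (nat \<Rightarrow> 'v rgraph) \<Rightarrow> (nat \<Rightarrow> 'v \<Rightarrow> 'v) \<Rightarrow> ((nat \<Rightarrow> 'v) \<Rightarrow> (nat \<Rightarrow> 'v)) set" where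
  "aut C A p =
     {\<sigma> \<in> homeos (limit_space A p). \<forall>B \<in> Obj C. \<forall>\<phi> \<in> limit_epi C A p B.
        compose (limit_points A p) \<phi> \<sigma> \<in> limit_epi C A p B \<and>
        compose (limit_points A p) \<phi> (map_inv (limit_points A p) \<sigma>) \<in> limit_epi C A p B}"

definition aut_topology ::
  "'v graph_class \<Rightarrow> (nat \<Rightarrow> 'v rgraph) \<Rightarrow> (nat \<Rightarrow> 'v \<Rightarrow> 'v) \<Rightarrow> ((nat \<Rightarrow> 'v) \<Rightarrow> (nat \<Rightarrow> 'v)) topology"
  where
  "aut_topology C A p = subtopology (homeo_topology (limit_space A p)) (aut C A p)"

definition quotient_space ::
  "'v graph_class \<Rightarrow> (nat \<Rightarrow> 'v rgraph) \<Rightarrow> (nat \<Rightarrow> 'v \<Rightarrow> 'v) \<Rightarrow> (nat \<Rightarrow> 'v) set topology" where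
  "quotient_space C A p = quotient_topology (limit_space A p) (limit_rel C A p)"

text \<open>The union below is over a single class when \<open>limit_rel C A p\<close> is transitive; see
  lemma \<open>pr_hom_apply\<close>.\<close>

definition pr_hom ::
  "'v graph_class \<Rightarrow> (nat \<Rightarrow> 'v rgraph) \<Rightarrow> (nat \<Rightarrow> 'v \<Rightarrow> 'v) \<Rightarrow>
   ((nat \<Rightarrow> 'v) \<Rightarrow> (nat \<Rightarrow> 'v)) \<Rightarrow> (nat \<Rightarrow> 'v) set \<Rightarrow> (nat \<Rightarrow> 'v) set" where
  "pr_hom C A p \<sigma> =
     (\<lambda>c \<in> limit_points A p // limit_rel C A p. \<Union>x\<in>c. limit_rel C A p `` {\<sigma> x})"

abbreviation power_topology :: "nat \<Rightarrow> 'a topology \<Rightarrow> (nat \<Rightarrow> 'a) topology" where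
  "power_topology n X \<equiv> product_topology (\<lambda>_. X) {..<n}"

definition pr_tuple ::
  "'v graph_class \<Rightarrow> (nat \<Rightarrow> 'v rgraph) \<Rightarrow> (nat \<Rightarrow> 'v \<Rightarrow> 'v) \<Rightarrow> nat \<Rightarrow>
   (nat \<Rightarrow> (nat \<Rightarrow> 'v) \<Rightarrow> (nat \<Rightarrow> 'v)) \<Rightarrow> nat \<Rightarrow> (nat \<Rightarrow> 'v) set \<Rightarrow> (nat \<Rightarrow> 'v) set" where
  "pr_tuple C A p n \<gamma> = (\<lambda>j\<in>{..<n}. pr_hom C A p (\<gamma> j))"

definition conj_orbit ::
  "'v graph_class \<Rightarrow> (nat \<Rightarrow> 'v rgraph) \<Rightarrow> (nat \<Rightarrow> 'v \<Rightarrow> 'v) \<Rightarrow> nat \<Rightarrow>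
   (nat \<Rightarrow> (nat \<Rightarrow> 'v) \<Rightarrow> (nat \<Rightarrow> 'v)) \<Rightarrow> (nat \<Rightarrow> (nat \<Rightarrow> 'v) \<Rightarrow> (nat \<Rightarrow> 'v)) set" where
  "conj_orbit C A p n \<gamma> =
     {(\<lambda>j\<in>{..<n}. compose (limit_points A p) g
         (compose (limit_points A p) (\<gamma> j) (map_inv (limit_points A p) g))) | g. g \<in> aut C A p}"

lemma homeos_bij_betw:
  assumes "\<sigma> \<in> homeos X"
  shows "bij_betw \<sigma> (topspace X) (topspace X)"
  using assms
  by (auto simp: homeos_def bij_betw_def dest: homeomorphic_imp_injective_map
      homeomorphic_imp_surjective_map)

lemma aut_bij_betw:
  assumes "\<sigma> \<in> aut C A p"
  shows "bij_betw \<sigma> (limit_points A p) (limit_points A p)"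
  using homeos_bij_betw[of \<sigma> "limit_space A p"] assms by (simp add: aut_def)

lemma aut_preserves_limit_rel:
  assumes \<sigma>: "\<sigma> \<in> aut C A p" and x: "x \<in> limit_points A p" and y: "y \<in> limit_points A p"
  shows "(\<sigma> x, \<sigma> y) \<in> limit_rel C A p \<longleftrightarrow> (x, y) \<in> limit_rel C A p"
proof
  let ?P = "limit_points A p"
  have bij: "bij_betw \<sigma> ?P ?P" using aut_bij_betw[OF \<sigma>] .
  have mem: "\<sigma> x \<in> ?P" "\<sigma> y \<in> ?P" using bij x y by (auto dest: bij_betwE)
  have inv: "map_inv ?P \<sigma> (\<sigma> x) = x" "map_inv ?P \<sigma> (\<sigma> y) = y"
    using bij x y mem by (auto simp: map_inv_def bij_betw_inv_into_left)
  {
    assume r: "(\<sigma> x, \<sigma> y) \<in> limit_rel C A p"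
    have "(\<phi> x, \<phi> y) \<in> rel B" if "B \<in> Obj C" "\<phi> \<in> limit_epi C A p B" for B \<phi>
    proof -
      have "compose ?P \<phi> (map_inv ?P \<sigma>) \<in> limit_epi C A p B"
        using \<sigma> that by (auto simp: aut_def)
      then have "(compose ?P \<phi> (map_inv ?P \<sigma>) (\<sigma> x), compose ?P \<phi> (map_inv ?P \<sigma>) (\<sigma> y)) \<in> rel B"
        using r that by (auto simp: limit_rel_def)
      then show ?thesis using mem inv by (simp add: compose_eq)
    qed
    then show "(x, y) \<in> limit_rel C A p"
      using x y by (auto simp: limit_rel_def)
  next
    assume r: "(x, y) \<in> limit_rel C A p"
    have "(\<phi> (\<sigma> x), \<phi> (\<sigma> y)) \<in> rel B" if "B \<in> Obj C" "\<phi> \<in> limit_epi C A p B" for B \<phi>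
    proof -
      have "compose ?P \<phi> \<sigma> \<in> limit_epi C A p B"
        using \<sigma> that by (auto simp: aut_def)
      then have "(compose ?P \<phi> \<sigma> x, compose ?P \<phi> \<sigma> y) \<in> rel B"
        using r that by (auto simp: limit_rel_def)
      then show ?thesis using x y by (simp add: compose_eq)
    qed
    then show "(\<sigma> x, \<sigma> y) \<in> limit_rel C A p"
      using mem by (auto simp: limit_rel_def)
  }
qed

lemma equiv_limit_rel:
  assumes C: "graph_category C" and A: "\<And>n. A n \<in> Obj C" and t: "trans (limit_rel C A p)"
  shows "equiv (limit_points A p) (limit_rel C A p)"
proof (rule equivI)
  show "limit_rel C A p \<subseteq> limit_points A p \<times> limit_points A p"
    by (auto simp: limit_rel_def)
  show "sym (limit_rel C A p)"
  proof (rule symI)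
    fix x y assume "(x, y) \<in> limit_rel C A p"
    then show "(y, x) \<in> limit_rel C A p"
      using C by (fastforce simp: limit_rel_def graph_category_def reflexive_graph_def dest: symD)
  qed
  show "refl_on (limit_points A p) (limit_rel C A p)"
  proof (rule refl_onI)
    fix x assume x: "x \<in> limit_points A p"
    have "(\<phi> x, \<phi> x) \<in> rel B" if B: "B \<in> Obj C" and \<phi>: "\<phi> \<in> limit_epi C A p B" for B \<phi>
    proof -
      obtain n f where f: "f \<in> Epi C (A n) B" "\<phi> = (\<lambda>x\<in>limit_points A p. f (x n))"
        using \<phi> by (auto simp: limit_epi_def)
      have "Epi C (A n) B \<subseteq> strong_homs (A n) B"
        using C A[of n] B unfolding graph_category_def by blast
      then have "f \<in> verts (A n) \<rightarrow>\<^sub>E verts B"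
        using f(1) unfolding strong_homs_def by blast
      moreover have "x n \<in> verts (A n)"
        using x unfolding limit_points_def by blast
      ultimately have "\<phi> x \<in> verts B"
        using f(2) x by auto
      moreover have "refl_on (verts B) (rel B)"
        using C B unfolding graph_category_def reflexive_graph_def by blast
      ultimately show ?thesis
        by (rule refl_onD[rotated])
    qed
    then show "(x, x) \<in> limit_rel C A p" using x by (auto simp: limit_rel_def)
  qed
  show "trans (limit_rel C A p)" by (rule t)
qed

lemma pr_hom_apply:
  assumes C: "graph_category C" and A: "\<And>n. A n \<in> Obj C" and t: "trans (limit_rel C A p)"
    and \<sigma>: "\<sigma> \<in> aut C A p" and x: "x \<in> limit_points A p"
  shows "pr_hom C A p \<sigma> (limit_rel C A p `` {x}) = limit_rel C A p `` {\<sigma> x}"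
proof -
  have e: "equiv (limit_points A p) (limit_rel C A p)"
    by (rule equiv_limit_rel[OF C A t])
  have "limit_rel C A p `` {\<sigma> y} = limit_rel C A p `` {\<sigma> x}"
    if "y \<in> limit_rel C A p `` {x}" for y
  proof -
    have "y \<in> limit_points A p" using that by (auto simp: limit_rel_def)
    then have "(\<sigma> x, \<sigma> y) \<in> limit_rel C A p"
      using that aut_preserves_limit_rel[OF \<sigma> x, of y] by simp
    then show ?thesis using equiv_class_eq[OF e, of "\<sigma> x" "\<sigma> y"] by simp
  qed
  moreover have "x \<in> limit_rel C A p `` {x}" using equiv_class_self[OF e x] .
  ultimately have "(\<Union>y\<in>limit_rel C A p `` {x}. limit_rel C A p `` {\<sigma> y}) =
      limit_rel C A p `` {\<sigma> x}"
    by blast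
  then show ?thesis
    unfolding pr_hom_def using restrict_apply'[OF quotientI[OF x]] by metis
qed

lemma pr_hom_in_homeos:
  assumes C: "graph_category C" and A: "\<And>n. A n \<in> Obj C" and t: "trans (limit_rel C A p)"
    and \<sigma>: "\<sigma> \<in> aut C A p"
  shows "pr_hom C A p \<sigma> \<in> homeos (quotient_space C A p)"
proof -
  let ?P = "limit_points A p" and ?R = "limit_rel C A p" and ?Q = "quotient_space C A p"
  let ?pr = "\<lambda>x. ?R `` {x}"
  have e: "equiv ?P ?R" by (rule equiv_limit_rel[OF C A t])
  have bij: "bij_betw \<sigma> ?P ?P" using aut_bij_betw[OF \<sigma>] .
  have q: "quotient_map (limit_space A p) ?Q ?pr"
    unfolding quotient_space_def by (rule quotient_map_quotient_topology)
  have "quotient_map (limit_space A p) (limit_space A p) \<sigma>"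
    using \<sigma> by (auto simp: aut_def homeos_def homeomorphic_map_def)
  then have "quotient_map (limit_space A p) ?Q (?pr \<circ> \<sigma>)"
    using q by (rule quotient_map_compose)
  then have "quotient_map (limit_space A p) ?Q (pr_hom C A p \<sigma> \<circ> ?pr)"
    by (rule quotient_map_eq) (simp add: pr_hom_apply[OF C A t \<sigma>])
  then have "quotient_map ?Q ?Q (pr_hom C A p \<sigma>)"
    by (simp only: quotient_map_compose_eq[OF q])
  moreover have "inj_on (pr_hom C A p \<sigma>) (topspace ?Q)"
  proof (rule inj_onI)
    fix c d assume "c \<in> topspace ?Q" "d \<in> topspace ?Q"
      and eq: "pr_hom C A p \<sigma> c = pr_hom C A p \<sigma> d"
    then obtain x y where xy: "x \<in> ?P" "c = ?pr x" "y \<in> ?P" "d = ?pr y"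
      by (auto simp: quotient_space_def quotient_def)
    then have "?pr (\<sigma> x) = ?pr (\<sigma> y)"
      using eq pr_hom_apply[OF C A t \<sigma>] by simp
    moreover have "\<sigma> y \<in> ?P" using bij xy by (auto dest: bij_betwE)
    ultimately have "(\<sigma> x, \<sigma> y) \<in> ?R"
      using eq_equiv_class[OF _ e] by blast
    then have "(x, y) \<in> ?R"
      using aut_preserves_limit_rel[OF \<sigma> \<open>x \<in> ?P\<close> \<open>y \<in> ?P\<close>] by blast
    then show "c = d" using equiv_class_eq[OF e] xy(2,4) by simp
  qed
  moreover have "pr_hom C A p \<sigma> \<in> extensional (topspace ?Q)"
    by (simp add: pr_hom_def quotient_space_def)
  ultimately show ?thesis
    by (simp add: homeos_def homeomorphic_map_def)
qed


section \<open>Tuples of partial morphisms and joint projection properties\<close>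

type_synonym 'v partial_tuple =
  "'v rgraph \<times> 'v rgraph \<times> (nat \<Rightarrow> 'v \<Rightarrow> 'v) \<times> (nat \<Rightarrow> 'v \<Rightarrow> 'v)"

definition partial_tuples :: "'v graph_class \<Rightarrow> nat \<Rightarrow> 'v partial_tuple set" where
  "partial_tuples C n =
     {(A, B, f, g) | A B f g. A \<in> Obj C \<and> B \<in> Obj C \<and>
        f \<in> {..<n} \<rightarrow>\<^sub>E Epi C A B \<and> g \<in> {..<n} \<rightarrow>\<^sub>E Epi C A B}"

fun tuple_epis ::
  "'v graph_class \<Rightarrow> nat \<Rightarrow> 'v partial_tuple \<Rightarrow> 'v partial_tuple \<Rightarrow> ('v \<Rightarrow> 'v) set" where
  "tuple_epis C n (A, B, f, g) (A', B', f', g') =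
     {\<alpha> \<in> Epi C A A'. \<forall>i<n. \<forall>a\<^sub>0 \<in> verts A. \<forall>a\<^sub>1 \<in> verts A.
        f i a\<^sub>0 = g i a\<^sub>1 \<longrightarrow> f' i (\<alpha> a\<^sub>0) = g' i (\<alpha> a\<^sub>1)}"

fun approx_tuple_epis ::
  "'v graph_class \<Rightarrow> nat \<Rightarrow> 'v partial_tuple \<Rightarrow> 'v partial_tuple \<Rightarrow> ('v \<Rightarrow> 'v) set" where
  "approx_tuple_epis C n (A, B, f, g) (A', B', f', g') =
     {\<alpha> \<in> Epi C A A'. \<forall>i<n. \<forall>a\<^sub>0 \<in> verts A. \<forall>a\<^sub>1 \<in> verts A.
        f i a\<^sub>0 = g i a\<^sub>1 \<longrightarrow> (f' i (\<alpha> a\<^sub>0), g' i (\<alpha> a\<^sub>1)) \<in> rel B'}"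

definition JPP :: "'v graph_class \<Rightarrow> nat \<Rightarrow> bool" where
  "JPP C n \<longleftrightarrow> (\<forall>X \<in> partial_tuples C n. \<forall>X' \<in> partial_tuples C n.
     \<exists>Y \<in> partial_tuples C n. tuple_epis C n Y X \<noteq> {} \<and> tuple_epis C n Y X' \<noteq> {})"

definition half_approx_JPP :: "'v graph_class \<Rightarrow> nat \<Rightarrow> bool" where
  "half_approx_JPP C n \<longleftrightarrow> (\<forall>X \<in> partial_tuples C n. \<forall>X' \<in> partial_tuples C n.
     \<exists>Y \<in> partial_tuples C n. tuple_epis C n Y X \<noteq> {} \<and> approx_tuple_epis C n Y X' \<noteq> {})"

definition approx_JPP :: "'v graph_class \<Rightarrow> nat \<Rightarrow> bool" where
  "approx_JPP C n \<longleftrightarrow> (\<forall>X \<in> partial_tuples C n. \<forall>X' \<in> partial_tuples C n.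
     \<exists>Y \<in> partial_tuples C n. approx_tuple_epis C n Y X \<noteq> {} \<and> approx_tuple_epis C n Y X' \<noteq> {})"

end

theory Submission
  imports Defs
begin

text \<open>
  By genericity the limit is homogeneous: any two epimorphisms from it to the same object differ by
  an automorphism (back and forth). Given \<open>u\<close> in \<open>Aut(K)\<^sup>n\<close> and a level \<open>m\<close>, the maps
  \<open>\<pi>\<^sub>m \<circ> u\<^sub>j\<close> and \<open>\<pi>\<^sub>m\<close> factor through a common \<open>A\<^sub>k\<close> and give a tuple \<open>X\<close>. Any tuple \<open>Y\<close> is
  realized by an epimorphism \<open>\<phi>\<close> and automorphisms \<open>\<sigma>\<^sub>j\<close> with \<open>f\<^sub>j \<circ> \<phi> = g\<^sub>j \<circ> \<phi> \<circ> \<sigma>\<^sub>j\<close>; an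
  epimorphism (approximate epimorphism) \<open>Y \<rightarrow> X\<close> yields, by homogeneity, a conjugate of \<open>\<sigma>\<close> whose
  \<open>m\<close>-th coordinates equal (are related to) those of \<open>u\<close>. Equality of \<open>m\<close>-th coordinates gives a
  basis of entourages on the limit; their being related gives, by compactness, arbitrarily small
  neighbourhoods of \<open>R\<close> and so controls distances in the quotient.
\<close>

locale generic_limit =
  fixes C :: "'v graph_class" and A :: "nat \<Rightarrow> 'v rgraph" and p :: "nat \<Rightarrow> 'v \<Rightarrow> 'v"
  assumes fraisse: "projective_fraisse_class C"
    and generic: "generic_sequence C A p"
begin

abbreviation \<KK> :: "(nat \<Rightarrow> 'v) set" where
  "\<KK> \<equiv> limit_points A p"

abbreviation E\<^sub>\<KK> :: "'v rgraph \<Rightarrow> ((nat \<Rightarrow> 'v) \<Rightarrow> 'v) set" where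
  "E\<^sub>\<KK> B \<equiv> limit_epi C A p B"

subsection \<open>Finite stages\<close>

lemma graph_category: "graph_category C"
  using fraisse unfolding projective_fraisse_class_def by blast

lemma Obj_A [simp]: "A m \<in> Obj C"
  using generic unfolding generic_sequence_def by blast

lemma Epi_p: "p m \<in> Epi C (A (Suc m)) (A m)"
  using generic unfolding generic_sequence_def by blast

lemma Epi_id: "B \<in> Obj C \<Longrightarrow> (\<lambda>x\<in>verts B. x) \<in> Epi C B B"
  using graph_category unfolding graph_category_def by blast

lemma Epi_compose:
  assumes "f \<in> Epi C B D" "g \<in> Epi C D F" "B \<in> Obj C" "D \<in> Obj C" "F \<in> Obj C"
  shows "compose (verts B) g f \<in> Epi C B F"
  using graph_category assms unfolding graph_category_def by blast

lemma Epi_strong: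
  assumes "f \<in> Epi C B D" "B \<in> Obj C" "D \<in> Obj C"
  shows "f \<in> strong_homs B D"
proof -
  have "\<forall>B\<in>Obj C. \<forall>D\<in>Obj C. Epi C B D \<subseteq> strong_homs B D"
    using graph_category unfolding graph_category_def by blast
  with assms show ?thesis by blast
qed

lemma Epi_maps:
  assumes "f \<in> Epi C B D" "B \<in> Obj C" "D \<in> Obj C" "a \<in> verts B"
  shows "f a \<in> verts D"
  using Epi_strong[OF assms(1-3)] assms(4) by (auto simp: strong_homs_def)

lemma Epi_rel:
  assumes "f \<in> Epi C B D" "B \<in> Obj C" "D \<in> Obj C" "(a, b) \<in> rel B"
  shows "(f a, f b) \<in> rel D"
  using Epi_strong[OF assms(1-3)] assms(4) by (auto simp: strong_homs_def)

lemma Obj_reflexive: "B \<in> Obj C \<Longrightarrow> reflexive_graph B"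
  and Obj_finite: "B \<in> Obj C \<Longrightarrow> finite (verts B)"
  using graph_category unfolding graph_category_def by auto

text \<open>Reflexivity turns surjectivity on related pairs into surjectivity on vertices: the loop
  at \<open>b\<close> is the image of some related pair.\<close>

lemma Epi_surj:
  assumes "f \<in> Epi C B D" "B \<in> Obj C" "D \<in> Obj C" "b \<in> verts D"
  shows "\<exists>a\<in>verts B. f a = b"
proof -
  have "(b, b) \<in> rel D"
    using Obj_reflexive[OF assms(3)] assms(4) by (auto simp: reflexive_graph_def refl_on_def)
  then obtain x y where "(x, y) \<in> rel B" "f x = b"
    using Epi_strong[OF assms(1-3)] unfolding strong_homs_def by blast
  moreover have "rel B \<subseteq> verts B \<times> verts B"
    using Obj_reflexive[OF assms(2)] by (simp add: reflexive_graph_def)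
  ultimately show ?thesis by blast
qed

lemma amalgamation:
  assumes "B \<in> Obj C" "D \<in> Obj C" "D' \<in> Obj C" "f \<in> Epi C D B" "f' \<in> Epi C D' B"
  obtains F g g' where "F \<in> Obj C" "g \<in> Epi C F D" "g' \<in> Epi C F D'"
    "compose (verts F) f g = compose (verts F) f' g'"
proof -
  have "\<forall>B\<in>Obj C. \<forall>D\<in>Obj C. \<forall>D'\<in>Obj C. \<forall>f\<in>Epi C D B. \<forall>f'\<in>Epi C D' B.
      \<exists>F\<in>Obj C. \<exists>g\<in>Epi C F D. \<exists>g'\<in>Epi C F D'. compose (verts F) f g = compose (verts F) f' g'"
    using fraisse unfolding projective_fraisse_class_def by (elim conjE)
  then have "\<exists>F\<in>Obj C. \<exists>g\<in>Epi C F D. \<exists>g'\<in>Epi C F D'.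
      compose (verts F) f g = compose (verts F) f' g'"
    using assms by simp
  then show ?thesis using that by blast
qed

lemma generic_factor:
  assumes "B \<in> Obj C" "f \<in> Epi C B (A m)"
  obtains k g where "m < k" "g \<in> Epi C (A k) B" "compose (verts (A k)) f g = bonding A p m k"
proof -
  have "\<forall>m. \<forall>B\<in>Obj C. \<forall>f\<in>Epi C B (A m). \<exists>k>m. \<exists>g\<in>Epi C (A k) B.
      compose (verts (A k)) f g = bonding A p m k"
    using generic unfolding generic_sequence_def by (elim conjE)
  then have "\<exists>k>m. \<exists>g\<in>Epi C (A k) B. compose (verts (A k)) f g = bonding A p m k"
    using assms by simp
  then show ?thesis using that by blast
qed

lemma bonding_Epi: "m \<le> k \<Longrightarrow> bonding A p m k \<in> Epi C (A k) (A m)"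
proof (induction k)
  case 0
  then show ?case using Epi_id[of "A 0"] by (simp del: restrict_apply)
next
  case (Suc k)
  show ?case
  proof (cases "m \<le> k")
    case True
    then show ?thesis using Epi_compose[OF Epi_p Suc.IH] by simp
  next
    case False
    then have "m = Suc k" using Suc.prems by simp
    then show ?thesis using Epi_id[of "A (Suc k)"] by (simp del: restrict_apply)
  qed
qed

lemma bonding_refl: "a \<in> verts (A m) \<Longrightarrow> bonding A p m m a = a"
  by (cases m) auto

lemma bonding_Suc:
  assumes "m \<le> k" "a \<in> verts (A (Suc k))"
  shows "bonding A p m (Suc k) a = bonding A p m k (p k a)"
  using assms by (simp only: bonding.simps if_True compose_eq)

text \<open>The recursion for \<open>bonding\<close> splits off the map at the upper index.
  Splitting off the one at the lower index shows that the images of a vertex at lower levels are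
  coherent.\<close>

lemma p_bonding:
  assumes "m < k" "a \<in> verts (A k)"
  shows "p m (bonding A p (Suc m) k a) = bonding A p m k a"
  using assms
proof (induction k arbitrary: a)
  case (Suc k)
  have a: "a \<in> verts (A (Suc k))" by fact
  have pk: "p k a \<in> verts (A k)"
    using Epi_maps[OF Epi_p _ _ a] by simp
  show ?case
  proof (cases "m < k")
    case True
    then have "Suc m \<le> k" "m \<le> k" by simp_all
    then show ?thesis using Suc.IH[OF True pk] by (simp only: bonding_Suc[OF _ a])
  next
    case False
    then have m: "m = k" using Suc.prems by simp
    show ?thesis
      by (simp only: m bonding_Suc[OF order_refl a] bonding_refl[OF a] bonding_refl[OF pk])
  qed
qed simp

subsection \<open>Points of the limit\<close>

lemma limit_mem: "x \<in> \<KK> \<Longrightarrow> x m \<in> verts (A m)"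
  and limit_step: "x \<in> \<KK> \<Longrightarrow> p m (x (Suc m)) = x m"
  by (auto simp: limit_points_def)

lemma bonding_limit:
  assumes "x \<in> \<KK>" "m \<le> k"
  shows "bonding A p m k (x k) = x m"
  using assms(2)
proof (induction k)
  case 0
  then show ?case using limit_mem[OF assms(1), of 0] by simp
next
  case (Suc k)
  then show ?case
    using limit_mem[OF assms(1), of "Suc k"] limit_step[OF assms(1), of k]
    by (auto simp: compose_eq le_Suc_eq)
qed

lemma limit_eq_mono:
  assumes "x \<in> \<KK>" "y \<in> \<KK>" "m \<le> k" "x k = y k"
  shows "x m = y m"
  using assms by (metis bonding_limit)

lemma limit_rel_mono:
  assumes "x \<in> \<KK>" "y \<in> \<KK>" "m \<le> k" "(x k, y k) \<in> rel (A k)"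
  shows "(x m, y m) \<in> rel (A m)"
  using Epi_rel[OF bonding_Epi[OF assms(3)] _ _ assms(4)] assms(1-3) by (simp add: bonding_limit)

text \<open>A vertex of \<open>A m\<close> extends to a thread: bonding maps fix the coordinates
  below \<open>m\<close>, and surjectivity of each \<open>p\<close> lets the higher ones be chosen
  one at a time.\<close>

lemma proj_surj:
  assumes "a \<in> verts (A m)"
  shows "\<exists>x\<in>\<KK>. x m = a"
proof -
  \<comment> \<open>\<open>y k\<close> is the coordinate at level \<open>m + k\<close>; the guard
    \<open>k = 0\<close> fixes the starting value of the dependent choice.\<close>
  have "\<exists>y. \<forall>k. (y k \<in> verts (A (m + k)) \<and> (k = 0 \<longrightarrow> y k = a)) \<and> p (m + k) (y (Suc k)) = y k"
  proof (rule dependent_nat_choice)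
    show "\<exists>b. b \<in> verts (A (m + 0)) \<and> (0 = 0 \<longrightarrow> b = a)" using assms by auto
    fix b :: 'v and k :: nat
    assume "b \<in> verts (A (m + k)) \<and> (k = 0 \<longrightarrow> b = a)"
    then have "\<exists>c\<in>verts (A (Suc (m + k))). p (m + k) c = b"
      using Epi_surj[OF Epi_p] by simp
    then show "\<exists>c. (c \<in> verts (A (m + Suc k)) \<and> (Suc k = 0 \<longrightarrow> c = a)) \<and> p (m + k) c = b"
      by auto
  qed
  then obtain y where y: "\<And>k. y k \<in> verts (A (m + k))" "y 0 = a"
      "\<And>k. p (m + k) (y (Suc k)) = y k"
    by auto
  \<comment> \<open>Both branches give \<open>a\<close> at level \<open>m\<close>, so coherence
    across the seam falls under the upper branch.\<close>
  define x where "x k = (if k \<le> m then bonding A p k m a else y (k - m))" for k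
  have "x k \<in> verts (A k) \<and> p k (x (Suc k)) = x k" for k
  proof (cases "k < m")
    case True
    then show ?thesis
      using Epi_maps[OF bonding_Epi[of k m]] assms p_bonding[OF True assms] by (simp add: x_def)
  next
    case False
    then obtain i where k: "k = m + i" using le_Suc_ex not_less by blast
    have "x (m + i) = y i" for i
      using bonding_refl[OF assms] y(2) by (auto simp: x_def)
    from this[of i] this[of "Suc i"] show ?thesis using y by (simp add: k)
  qed
  then have "x \<in> \<KK>" by (simp add: limit_points_def)
  moreover have "x m = a" using bonding_refl[OF assms] by (simp add: x_def)
  ultimately show ?thesis by blast
qed

subsection \<open>Epimorphisms from the limit\<close>

text \<open>Composing with a bonding map moves a representative to any higher level, so finitely
  many epimorphisms can be represented at one common level.\<close>

lemma limit_epi_eventually: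
  assumes "B \<in> Obj C" "\<phi> \<in> E\<^sub>\<KK> B"
  obtains i where "\<And>k. i \<le> k \<Longrightarrow> \<exists>f\<in>Epi C (A k) B. \<phi> = (\<lambda>x\<in>\<KK>. f (x k))"
proof -
  obtain i f where f: "f \<in> Epi C (A i) B" "\<phi> = (\<lambda>x\<in>\<KK>. f (x i))"
    using assms(2) unfolding limit_epi_def by blast
  show ?thesis
  proof (rule that)
    fix k assume k: "i \<le> k"
    let ?g = "compose (verts (A k)) f (bonding A p i k)"
    have "?g \<in> Epi C (A k) B"
      by (rule Epi_compose[OF bonding_Epi[OF k] f(1)]) (use assms(1) in auto)
    moreover have "\<phi> = (\<lambda>x\<in>\<KK>. ?g (x k))"
      using f(2) k by (auto simp: fun_eq_iff compose_eq limit_mem bonding_limit)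
    ultimately show "\<exists>f\<in>Epi C (A k) B. \<phi> = (\<lambda>x\<in>\<KK>. f (x k))" by blast
  qed
qed

lemma limit_epi_level:
  assumes "B \<in> Obj C" "\<phi> \<in> E\<^sub>\<KK> B"
  obtains k f where "m \<le> k" "f \<in> Epi C (A k) B" "\<phi> = (\<lambda>x\<in>\<KK>. f (x k))"
  using limit_epi_eventually[OF assms] by (metis max.cobounded1 max.cobounded2)

lemma limit_epi_compose:
  assumes "B \<in> Obj C" "D \<in> Obj C" "\<phi> \<in> E\<^sub>\<KK> B" "e \<in> Epi C B D"
  shows "compose \<KK> e \<phi> \<in> E\<^sub>\<KK> D"
proof -
  obtain k f where f: "f \<in> Epi C (A k) B" "\<phi> = (\<lambda>x\<in>\<KK>. f (x k))"
    using limit_epi_level[OF assms(1,3)] by blast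
  have "compose \<KK> e \<phi> = (\<lambda>x\<in>\<KK>. compose (verts (A k)) e f (x k))"
    by (auto simp: fun_eq_iff f(2) compose_def limit_mem)
  moreover have "compose (verts (A k)) e f \<in> Epi C (A k) D"
    using Epi_compose[OF f(1) assms(4)] assms by simp
  ultimately show ?thesis unfolding limit_epi_def by blast
qed

lemma proj_limit_epi: "(\<lambda>x\<in>\<KK>. x m) \<in> E\<^sub>\<KK> (A m)"
proof -
  have "(\<lambda>x\<in>\<KK>. x m) = (\<lambda>x\<in>\<KK>. (\<lambda>a\<in>verts (A m). a) (x m))"
    by (auto simp: fun_eq_iff limit_mem)
  then show ?thesis using Epi_id[OF Obj_A] unfolding limit_epi_def by blast
qed

lemma limit_epi_maps:
  assumes "B \<in> Obj C" "\<phi> \<in> E\<^sub>\<KK> B" "x \<in> \<KK>"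
  shows "\<phi> x \<in> verts B"
proof -
  obtain k f where f: "f \<in> Epi C (A k) B" "\<phi> = (\<lambda>x\<in>\<KK>. f (x k))"
    using limit_epi_level[OF assms(1,2)] by blast
  then show ?thesis
    using Epi_maps[OF f(1) Obj_A assms(1) limit_mem[OF assms(3)]] assms(3) by simp
qed

lemma limit_epi_surj:
  assumes "B \<in> Obj C" "\<phi> \<in> E\<^sub>\<KK> B" "b \<in> verts B"
  shows "\<exists>x\<in>\<KK>. \<phi> x = b"
proof -
  obtain k f where f: "f \<in> Epi C (A k) B" "\<phi> = (\<lambda>x\<in>\<KK>. f (x k))"
    using limit_epi_level[OF assms(1,2)] by blast
  obtain a where "a \<in> verts (A k)" "f a = b"
    using Epi_surj[OF f(1) _ assms(1,3)] by auto
  then show ?thesis using proj_surj f(2) by auto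
qed

lemma limit_epi_nonempty: "B \<in> Obj C \<Longrightarrow> \<exists>\<phi>. \<phi> \<in> E\<^sub>\<KK> B"
proof -
  assume "B \<in> Obj C"
  moreover have "\<forall>B\<in>Obj C. \<exists>m. Epi C (A m) B \<noteq> {}"
    using generic unfolding generic_sequence_def by (elim conjE)
  ultimately show ?thesis unfolding limit_epi_def by blast
qed

text \<open>Amalgamate \<open>f\<close> with a representative \<open>h\<close> of
  \<open>\<phi>\<close>; by genericity a later stage maps onto the amalgam compatibly with the
  bonding map.\<close>

lemma limit_epi_lift:
  assumes "B \<in> Obj C" "D \<in> Obj C" "\<phi> \<in> E\<^sub>\<KK> B" "f \<in> Epi C D B"
  obtains \<psi> where "\<psi> \<in> E\<^sub>\<KK> D" "\<And>x. x \<in> \<KK> \<Longrightarrow> f (\<psi> x) = \<phi> x"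
proof -
  obtain m h where h: "h \<in> Epi C (A m) B" "\<phi> = (\<lambda>x\<in>\<KK>. h (x m))"
    using limit_epi_level[OF assms(1,3)] by blast
  obtain F g g' where F: "F \<in> Obj C" "g \<in> Epi C F D" "g' \<in> Epi C F (A m)"
      and c: "compose (verts F) f g = compose (verts F) h g'"
    using amalgamation[OF assms(1,2) Obj_A assms(4) h(1)] by blast
  obtain k u where k: "u \<in> Epi C (A k) F" "m < k"
      and u: "compose (verts (A k)) g' u = bonding A p m k"
    using generic_factor[OF F(1,3)] by blast
  \<comment> \<open>On stage \<open>k\<close>,
    \<open>f \<circ> g \<circ> u = h \<circ> g' \<circ> u\<close>, and \<open>g' \<circ> u\<close>
    is the bonding map to \<open>A m\<close>; hence the lift is \<open>g \<circ> u\<close> read at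
    coordinate \<open>k\<close>.\<close>
  let ?\<psi> = "\<lambda>x\<in>\<KK>. compose (verts (A k)) g u (x k)"
  have "?\<psi> \<in> E\<^sub>\<KK> D"
    using Epi_compose[OF k(1) F(2)] F assms(2) unfolding limit_epi_def by auto
  moreover have "f (?\<psi> x) = \<phi> x" if x: "x \<in> \<KK>" for x
  proof -
    have xk: "x k \<in> verts (A k)" and uk: "u (x k) \<in> verts F"
      using limit_mem[OF x] Epi_maps[OF k(1) _ F(1)] by auto
    have "f (g (u (x k))) = h (g' (u (x k)))"
      using fun_cong[OF c, of "u (x k)"] uk by (simp add: compose_eq)
    also have "g' (u (x k)) = x m"
      using fun_cong[OF u, of "x k"] xk bonding_limit[OF x, of m k] k(2) by (simp add: compose_eq)
    finally show ?thesis using x xk h(2) by (simp add: compose_eq)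
  qed
  ultimately show ?thesis using that by blast
qed

subsection \<open>The automorphism group\<close>

lemma continuous_proj:
  "continuous_map (limit_space A p) (discrete_topology (verts (A m))) (\<lambda>x. x m)"
  unfolding limit_space_def
  by (intro continuous_map_from_subtopology continuous_map_product_projection) simp

text \<open>Each coordinate of \<open>\<sigma>\<close> factors through a projection to a finite
  discrete stage, hence is continuous; the limit carries the product topology.\<close>

lemma continuous_map_limit_space:
  assumes maps: "\<And>x. x \<in> \<KK> \<Longrightarrow> \<sigma> x \<in> \<KK>"
    and epi: "\<And>m. compose \<KK> (\<lambda>x\<in>\<KK>. x m) \<sigma> \<in> E\<^sub>\<KK> (A m)"
  shows "continuous_map (limit_space A p) (limit_space A p) \<sigma>"
proof -
  have "continuous_map (limit_space A p) (discrete_topology (verts (A m))) (\<lambda>x. \<sigma> x m)" for m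
  proof -
    obtain k f where f: "f \<in> Epi C (A k) (A m)" "compose \<KK> (\<lambda>x\<in>\<KK>. x m) \<sigma> = (\<lambda>x\<in>\<KK>. f (x k))"
      using limit_epi_level[OF Obj_A epi] by metis
    have "continuous_map (limit_space A p) (discrete_topology (verts (A m))) (f \<circ> (\<lambda>x. x k))"
      by (rule continuous_map_compose[OF continuous_proj]) (auto intro: Epi_maps[OF f(1)])
    then show ?thesis
    proof (rule continuous_map_eq)
      fix x assume "x \<in> topspace (limit_space A p)"
      then show "(f \<circ> (\<lambda>x. x k)) x = \<sigma> x m"
        using fun_cong[OF f(2), of x] maps[of x] by (simp add: compose_eq)
    qed
  qed
  then have "continuous_map (limit_space A p)
      (product_topology (\<lambda>m. discrete_topology (verts (A m))) UNIV) \<sigma>"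
    by (simp add: continuous_map_componentwise_UNIV)
  then show ?thesis
    using maps by (subst (2) limit_space_def) (auto simp: continuous_map_in_subtopology)
qed

lemma aut_compose_epi:
  assumes "\<sigma> \<in> aut C A p" "B \<in> Obj C" "\<phi> \<in> E\<^sub>\<KK> B"
  shows "compose \<KK> \<phi> \<sigma> \<in> E\<^sub>\<KK> B" "compose \<KK> \<phi> (map_inv \<KK> \<sigma>) \<in> E\<^sub>\<KK> B"
  using assms unfolding aut_def by blast+

lemma aut_maps: "\<sigma> \<in> aut C A p \<Longrightarrow> x \<in> \<KK> \<Longrightarrow> \<sigma> x \<in> \<KK>"
  using bij_betwE[OF aut_bij_betw[of \<sigma> C A p]] by blast

lemma map_inv_maps: "\<sigma> \<in> aut C A p \<Longrightarrow> x \<in> \<KK> \<Longrightarrow> map_inv \<KK> \<sigma> x \<in> \<KK>"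
  and map_inv_left: "\<sigma> \<in> aut C A p \<Longrightarrow> x \<in> \<KK> \<Longrightarrow> map_inv \<KK> \<sigma> (\<sigma> x) = x"
  and map_inv_right: "\<sigma> \<in> aut C A p \<Longrightarrow> x \<in> \<KK> \<Longrightarrow> \<sigma> (map_inv \<KK> \<sigma> x) = x"
  using aut_bij_betw[of \<sigma> C A p] aut_maps[of \<sigma> x]
  by (auto simp: map_inv_def bij_betw_inv_into_left bij_betw_inv_into_right bij_betw_def
      inv_into_into)

text \<open>Continuity of \<open>\<sigma>\<close> and \<open>\<tau>\<close> is derived from their
  effect on the projections, so that the back-and-forth construction has to supply only algebraic
  data.\<close>

lemma autI:
  assumes maps: "\<And>x. x \<in> \<KK> \<Longrightarrow> \<sigma> x \<in> \<KK>" "\<And>x. x \<in> \<KK> \<Longrightarrow> \<tau> x \<in> \<KK>"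
    and inv: "\<And>x. x \<in> \<KK> \<Longrightarrow> \<tau> (\<sigma> x) = x" "\<And>x. x \<in> \<KK> \<Longrightarrow> \<sigma> (\<tau> x) = x"
    and epi: "\<And>B \<phi>. B \<in> Obj C \<Longrightarrow> \<phi> \<in> E\<^sub>\<KK> B \<Longrightarrow> compose \<KK> \<phi> \<sigma> \<in> E\<^sub>\<KK> B"
      "\<And>B \<phi>. B \<in> Obj C \<Longrightarrow> \<phi> \<in> E\<^sub>\<KK> B \<Longrightarrow> compose \<KK> \<phi> \<tau> \<in> E\<^sub>\<KK> B"
    and ext: "\<sigma> \<in> extensional \<KK>"
  shows "\<sigma> \<in> aut C A p"
proof -
  have bij: "bij_betw \<sigma> \<KK> \<KK>"
    using maps inv by (intro bij_betw_byWitness[where f' = \<tau>]) auto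
  have "homeomorphic_maps (limit_space A p) (limit_space A p) \<sigma> \<tau>"
    unfolding homeomorphic_maps_def
    using inv continuous_map_limit_space[OF maps(1) epi(1)[OF Obj_A proj_limit_epi]]
      continuous_map_limit_space[OF maps(2) epi(2)[OF Obj_A proj_limit_epi]]
    by simp
  then have "homeomorphic_map (limit_space A p) (limit_space A p) \<sigma>"
    using homeomorphic_maps_imp_map by blast
  \<comment> \<open>\<open>aut\<close> is stated with \<open>map_inv\<close>; it agrees with the
    given inverse \<open>\<tau>\<close> on \<open>\<KK>\<close>, the only place where
    \<open>compose\<close> evaluates it.\<close>
  moreover have "compose \<KK> \<phi> (map_inv \<KK> \<sigma>) = compose \<KK> \<phi> \<tau>" for \<phi> :: "(nat \<Rightarrow> 'v) \<Rightarrow> 'v"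
    using bij maps inv
    by (auto simp: fun_eq_iff compose_def map_inv_def bij_betw_def intro!: arg_cong[of _ _ \<phi>]
        inv_into_f_eq)
  ultimately show ?thesis using epi ext by (auto simp: aut_def homeos_def)
qed

lemma aut_map_inv: "\<sigma> \<in> aut C A p \<Longrightarrow> map_inv \<KK> \<sigma> \<in> aut C A p"
  by (rule autI[where \<tau> = \<sigma>])
    (simp_all add: aut_maps map_inv_maps map_inv_left map_inv_right aut_compose_epi,
      simp add: map_inv_def)

lemma aut_compose:
  assumes "\<sigma> \<in> aut C A p" "\<tau> \<in> aut C A p"
  shows "compose \<KK> \<sigma> \<tau> \<in> aut C A p"
proof (rule autI[where \<tau> = "compose \<KK> (map_inv \<KK> \<tau>) (map_inv \<KK> \<sigma>)"])
  fix B :: "'v rgraph" and \<phi> assume B: "B \<in> Obj C" "\<phi> \<in> E\<^sub>\<KK> B"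
  have "compose \<KK> \<phi> (compose \<KK> \<sigma> \<tau>) = compose \<KK> (compose \<KK> \<phi> \<sigma>) \<tau>"
    using assms by (auto simp: fun_eq_iff compose_def aut_maps)
  then show "compose \<KK> \<phi> (compose \<KK> \<sigma> \<tau>) \<in> E\<^sub>\<KK> B"
    using assms B by (simp add: aut_compose_epi)
  have "compose \<KK> \<phi> (compose \<KK> (map_inv \<KK> \<tau>) (map_inv \<KK> \<sigma>)) =
      compose \<KK> (compose \<KK> \<phi> (map_inv \<KK> \<tau>)) (map_inv \<KK> \<sigma>)"
    using assms by (auto simp: fun_eq_iff compose_def map_inv_maps)
  then show "compose \<KK> \<phi> (compose \<KK> (map_inv \<KK> \<tau>) (map_inv \<KK> \<sigma>)) \<in> E\<^sub>\<KK> B"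
    using assms B by (simp add: aut_compose_epi)
qed (use assms in \<open>auto simp: compose_eq aut_maps map_inv_maps map_inv_left map_inv_right\<close>)

subsection \<open>Projective ultrahomogeneity\<close>

text \<open>A zig-zag refines both maps through the same \<open>e = f \<circ> g\<close>: lift
  \<open>\<psi>\<close> along a representative \<open>f\<close> of \<open>\<phi>\<close> at level
  \<open>k\<close>, then lift the projection to \<open>A k\<close> along a representative
  \<open>g\<close> of that lift at level \<open>l\<close>. The second lift is
  \<open>\<phi>'\<close>, and \<open>\<psi>'\<close> is the projection to \<open>A l\<close>. Both
  determine coordinate \<open>i\<close> because \<open>k\<close> and \<open>l\<close> are at least
  \<open>i\<close>.\<close>

lemma back_and_forth_step:
  assumes B: "B \<in> Obj C" and \<phi>: "\<phi> \<in> E\<^sub>\<KK> B" and \<psi>: "\<psi> \<in> E\<^sub>\<KK> B"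
  obtains D \<phi>' \<psi>' e s t where "D \<in> Obj C" "\<phi>' \<in> E\<^sub>\<KK> D" "\<psi>' \<in> E\<^sub>\<KK> D"
    "s \<in> Epi C D (A i)" "t \<in> Epi C D (A i)"
    "\<And>x. x \<in> \<KK> \<Longrightarrow> e (\<phi>' x) = \<phi> x" "\<And>x. x \<in> \<KK> \<Longrightarrow> e (\<psi>' x) = \<psi> x"
    "\<And>x. x \<in> \<KK> \<Longrightarrow> s (\<phi>' x) = x i" "\<And>x. x \<in> \<KK> \<Longrightarrow> t (\<psi>' x) = x i"
proof -
  obtain k f where k: "i \<le> k" and f: "f \<in> Epi C (A k) B" "\<phi> = (\<lambda>x\<in>\<KK>. f (x k))"
    using limit_epi_level[OF B \<phi>] by blast
  obtain \<psi>1 where \<psi>1: "\<psi>1 \<in> E\<^sub>\<KK> (A k)" "\<And>x. x \<in> \<KK> \<Longrightarrow> f (\<psi>1 x) = \<psi> x"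
    using limit_epi_lift[OF B Obj_A \<psi> f(1)] by blast
  obtain l g where l: "i \<le> l" and g: "g \<in> Epi C (A l) (A k)" "\<psi>1 = (\<lambda>x\<in>\<KK>. g (x l))"
    using limit_epi_level[OF Obj_A \<psi>1(1)] by blast
  obtain \<phi>' where \<phi>': "\<phi>' \<in> E\<^sub>\<KK> (A l)" "\<And>x. x \<in> \<KK> \<Longrightarrow> g (\<phi>' x) = (\<lambda>x\<in>\<KK>. x k) x"
    using limit_epi_lift[OF Obj_A Obj_A proj_limit_epi g(1)] by blast
  show ?thesis
  proof (rule that[OF Obj_A \<phi>'(1) proj_limit_epi])
    show "compose (verts (A l)) (bonding A p i k) g \<in> Epi C (A l) (A i)"
      by (rule Epi_compose[OF g(1) bonding_Epi[OF k]]) auto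
    show "bonding A p i l \<in> Epi C (A l) (A i)" by (rule bonding_Epi[OF l])
    fix x assume x: "x \<in> \<KK>"
    show "(f \<circ> g) (\<phi>' x) = \<phi> x" using \<phi>'(2)[OF x] x f(2) by simp
    show "(f \<circ> g) ((\<lambda>x\<in>\<KK>. x l) x) = \<psi> x" using \<psi>1(2)[OF x] x g(2) by simp
    show "compose (verts (A l)) (bonding A p i k) g (\<phi>' x) = x i"
      using \<phi>'(2)[OF x] x limit_epi_maps[OF Obj_A \<phi>'(1) x] bonding_limit[OF x k]
      by (simp add: compose_eq)
    show "bonding A p i l ((\<lambda>x\<in>\<KK>. x l) x) = x i"
      using x bonding_limit[OF x l] by simp
  qed
qed

text \<open>One half of the back and forth: \<open>\<psi> i x\<close> prescribes the value of
  \<open>\<phi> i\<close> at the image of \<open>x\<close>, and \<open>s i\<close> reads coordinate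
  \<open>i\<close> of the image off that prescription.\<close>

lemma thread_map:
  assumes B: "\<And>i. B i \<in> Obj C" and \<phi>: "\<And>i. \<phi> i \<in> E\<^sub>\<KK> (B i)" and \<psi>: "\<And>i. \<psi> i \<in> E\<^sub>\<KK> (B i)"
    and e: "\<And>i x. x \<in> \<KK> \<Longrightarrow> e i (\<phi> (Suc i) x) = \<phi> i x"
      "\<And>i x. x \<in> \<KK> \<Longrightarrow> e i (\<psi> (Suc i) x) = \<psi> i x"
    and s: "\<And>i. s i \<in> Epi C (B i) (A i)" "\<And>i x. x \<in> \<KK> \<Longrightarrow> s i (\<phi> i x) = x i"
  obtains \<sigma> where "\<sigma> \<in> extensional \<KK>" "\<And>x. x \<in> \<KK> \<Longrightarrow> \<sigma> x \<in> \<KK>"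
    "\<And>i x. x \<in> \<KK> \<Longrightarrow> \<phi> i (\<sigma> x) = \<psi> i x"
    "\<And>D \<theta>. D \<in> Obj C \<Longrightarrow> \<theta> \<in> E\<^sub>\<KK> D \<Longrightarrow> compose \<KK> \<theta> \<sigma> \<in> E\<^sub>\<KK> D"
proof -
  define \<sigma> where "\<sigma> = (\<lambda>x\<in>\<KK>. \<lambda>i. s i (\<psi> i x))"
  have down: "\<phi> i y = \<psi> i x"
    if "i \<le> k" "x \<in> \<KK>" "y \<in> \<KK>" "\<phi> k y = \<psi> k x" for i k x y
    using that(1,4)
  proof (induction k)
    case (Suc k)
    have "\<phi> k y = \<psi> k x"
      using e(1)[OF that(3), of k] e(2)[OF that(2), of k] Suc.prems(2) by simp
    then show ?case using Suc by (auto simp: le_Suc_eq)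
  qed simp
  \<comment> \<open>Surjectivity of \<open>\<phi> k\<close> yields an actual point meeting all
    prescriptions up to level \<open>k\<close>. It shares its coordinates up to \<open>k\<close>
    with \<open>\<sigma> x\<close>, so properties of \<open>\<sigma> x\<close> involving finitely
    many coordinates can be read off it.\<close>
  have approx: "\<exists>y\<in>\<KK>. \<forall>i\<le>k. \<phi> i y = \<psi> i x \<and> \<sigma> x i = y i" if x: "x \<in> \<KK>" for x k
  proof -
    obtain y where "y \<in> \<KK>" "\<phi> k y = \<psi> k x"
      using limit_epi_surj[OF B \<phi> limit_epi_maps[OF B \<psi> x]] by blast
    then have "\<forall>i\<le>k. \<phi> i y = \<psi> i x" "y \<in> \<KK>" using down x by auto
    moreover have "\<sigma> x i = s i (\<psi> i x)" for i using x by (simp add: \<sigma>_def)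
    ultimately show ?thesis by (metis s(2))
  qed
  have maps: "\<sigma> x \<in> \<KK>" if "x \<in> \<KK>" for x
  proof -
    have "\<sigma> x k \<in> verts (A k) \<and> p k (\<sigma> x (Suc k)) = \<sigma> x k" for k
    proof -
      obtain y where "y \<in> \<KK>" "\<forall>i\<le>Suc k. \<sigma> x i = y i"
        using approx[OF \<open>x \<in> \<KK>\<close>, of "Suc k"] by blast
      then show ?thesis by (simp add: limit_mem limit_step)
    qed
    then show ?thesis by (simp add: limit_points_def)
  qed
  show ?thesis
  proof (rule that[OF _ maps])
    show "\<sigma> \<in> extensional \<KK>" by (simp add: \<sigma>_def)
    show "\<phi> i (\<sigma> x) = \<psi> i x" if x: "x \<in> \<KK>" for i x
    proof -
      \<comment> \<open>\<open>\<phi> i\<close> depends on the single coordinate \<open>k\<close>,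
        so a point agreeing with \<open>\<sigma> x\<close> up to \<open>max i k\<close> decides its
        value.\<close>
      obtain k f where f: "\<phi> i = (\<lambda>x\<in>\<KK>. f (x k))"
        using limit_epi_level[OF B \<phi>] by metis
      obtain y where y: "y \<in> \<KK>" "\<forall>l\<le>max i k. \<phi> l y = \<psi> l x \<and> \<sigma> x l = y l"
        using approx[OF x] by blast
      then have "\<phi> i (\<sigma> x) = \<phi> i y" using f maps[OF x] by simp
      then show ?thesis using y by simp
    qed
    show "compose \<KK> \<theta> \<sigma> \<in> E\<^sub>\<KK> D" if D: "D \<in> Obj C" "\<theta> \<in> E\<^sub>\<KK> D" for D \<theta>
    proof -
      obtain k f where f: "f \<in> Epi C (A k) D" "\<theta> = (\<lambda>x\<in>\<KK>. f (x k))"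
        using limit_epi_level[OF D] by blast
      \<comment> \<open>Coordinate \<open>k\<close> of \<open>\<sigma>\<close> is
        \<open>s k \<circ> \<psi> k\<close>, so the composite is an epimorphism from the limit
        followed by the finite morphisms \<open>s k\<close> and \<open>f\<close>.\<close>
      have "compose \<KK> \<theta> \<sigma> = compose \<KK> f (compose \<KK> (s k) (\<psi> k))"
        using maps f(2) by (auto simp: fun_eq_iff compose_def \<sigma>_def)
      then show ?thesis
        using limit_epi_compose[OF Obj_A D(1) limit_epi_compose[OF B Obj_A \<psi> s(1)] f(1)] by simp
    qed
  qed
qed

text \<open>Iterating the refinement makes both maps determine more and more coordinates; two uses
  of \<open>thread_map\<close>, with the roles of the maps exchanged, then give mutually inverse
  maps of the limit.\<close>

lemma homogeneous:
  assumes "B \<in> Obj C" "\<phi> \<in> E\<^sub>\<KK> B" "\<psi> \<in> E\<^sub>\<KK> B"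
  obtains \<sigma> where "\<sigma> \<in> aut C A p" "\<And>x. x \<in> \<KK> \<Longrightarrow> \<phi> (\<sigma> x) = \<psi> x"
proof -
  define good where "good i S \<longleftrightarrow> (case S of (B, \<phi>, \<psi>) \<Rightarrow> B \<in> Obj C \<and> \<phi> \<in> E\<^sub>\<KK> B \<and> \<psi> \<in> E\<^sub>\<KK> B \<and>
      (\<exists>s\<in>Epi C B (A i). \<forall>x\<in>\<KK>. s (\<phi> x) = x i) \<and> (\<exists>t\<in>Epi C B (A i). \<forall>x\<in>\<KK>. t (\<psi> x) = x i))"
    for i :: nat and S
  \<comment> \<open>The same \<open>e\<close> serves both components; this is what makes a
    prescription met at one level be met at all lower levels.\<close>
  define above where "above S S' \<longleftrightarrow> (\<exists>e. case S of (B, \<phi>, \<psi>) \<Rightarrow> case S' of (B', \<phi>', \<psi>') \<Rightarrow>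
      \<forall>x\<in>\<KK>. e (\<phi>' x) = \<phi> x \<and> e (\<psi>' x) = \<psi> x)"
    for S S' :: "'v rgraph \<times> ((nat \<Rightarrow> 'v) \<Rightarrow> 'v) \<times> ((nat \<Rightarrow> 'v) \<Rightarrow> 'v)"
  have step: "\<exists>S'. good i S' \<and> above (B, \<phi>, \<psi>) S'"
    if "B \<in> Obj C" "\<phi> \<in> E\<^sub>\<KK> B" "\<psi> \<in> E\<^sub>\<KK> B" for i B \<phi> \<psi>
  proof (rule back_and_forth_step[OF that, of i])
    fix D \<phi>' \<psi>' e s t
    assume "D \<in> Obj C" "\<phi>' \<in> E\<^sub>\<KK> D" "\<psi>' \<in> E\<^sub>\<KK> D"
      "s \<in> Epi C D (A i)" "t \<in> Epi C D (A i)"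
      "\<And>x. x \<in> \<KK> \<Longrightarrow> e (\<phi>' x) = \<phi> x" "\<And>x. x \<in> \<KK> \<Longrightarrow> e (\<psi>' x) = \<psi> x"
      "\<And>x. x \<in> \<KK> \<Longrightarrow> s (\<phi>' x) = x i" "\<And>x. x \<in> \<KK> \<Longrightarrow> t (\<psi>' x) = x i"
    then have "good i (D, \<phi>', \<psi>')" "above (B, \<phi>, \<psi>) (D, \<phi>', \<psi>')"
      unfolding good_def above_def by (simp_all, blast+)
    then show ?thesis by blast
  qed
  \<comment> \<open>The given maps need not determine coordinate 0, so they precede the chain
    instead of starting it; the guard \<open>i = 0\<close> ties them to its first member.\<close>
  have "\<exists>S. \<forall>i. (good i (S i) \<and> (i = 0 \<longrightarrow> above (B, \<phi>, \<psi>) (S i))) \<and> above (S i) (S (Suc i))"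
  proof (rule dependent_nat_choice)
    show "\<exists>S. good 0 S \<and> (0 = 0 \<longrightarrow> above (B, \<phi>, \<psi>) S)"
      using step[OF assms] by blast
    show "\<exists>S'. (good (Suc i) S' \<and> (Suc i = 0 \<longrightarrow> above (B, \<phi>, \<psi>) S')) \<and> above S S'"
      if "good i S \<and> (i = 0 \<longrightarrow> above (B, \<phi>, \<psi>) S)" for i S
    proof -
      obtain B' \<phi>' \<psi>' where S: "S = (B', \<phi>', \<psi>')" by (metis prod_cases3)
      have "B' \<in> Obj C" "\<phi>' \<in> E\<^sub>\<KK> B'" "\<psi>' \<in> E\<^sub>\<KK> B'"
        using that by (auto simp: S good_def)
      from step[OF this] show ?thesis by (auto simp: S)
    qed
  qed
  then obtain S where S: "\<And>i. good i (S i)" "above (B, \<phi>, \<psi>) (S 0)" "\<And>i. above (S i) (S (Suc i))"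
    by blast
  define D where "D i = fst (S i)" for i
  define \<Phi> where "\<Phi> i = fst (snd (S i))" for i
  define \<Psi> where "\<Psi> i = snd (snd (S i))" for i
  have Si: "S i = (D i, \<Phi> i, \<Psi> i)" for i by (simp add: D_def \<Phi>_def \<Psi>_def)
  have D: "\<And>i. D i \<in> Obj C" "\<And>i. \<Phi> i \<in> E\<^sub>\<KK> (D i)" "\<And>i. \<Psi> i \<in> E\<^sub>\<KK> (D i)"
    and st: "\<And>i. \<exists>s\<in>Epi C (D i) (A i). \<forall>x\<in>\<KK>. s (\<Phi> i x) = x i"
      "\<And>i. \<exists>t\<in>Epi C (D i) (A i). \<forall>x\<in>\<KK>. t (\<Psi> i x) = x i"
    using S(1) by (auto simp: good_def Si)
  obtain s where s: "\<And>i. s i \<in> Epi C (D i) (A i)" "\<And>i x. x \<in> \<KK> \<Longrightarrow> s i (\<Phi> i x) = x i"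
    using st(1) by metis
  obtain t where t: "\<And>i. t i \<in> Epi C (D i) (A i)" "\<And>i x. x \<in> \<KK> \<Longrightarrow> t i (\<Psi> i x) = x i"
    using st(2) by metis
  have "\<exists>e. \<forall>x\<in>\<KK>. e (\<Phi> (Suc i) x) = \<Phi> i x \<and> e (\<Psi> (Suc i) x) = \<Psi> i x" for i
    using S(3)[of i] by (simp add: above_def Si)
  then obtain e where e: "\<And>i x. x \<in> \<KK> \<Longrightarrow> e i (\<Phi> (Suc i) x) = \<Phi> i x"
      "\<And>i x. x \<in> \<KK> \<Longrightarrow> e i (\<Psi> (Suc i) x) = \<Psi> i x"
    by metis
  obtain e0 where e0: "\<And>x. x \<in> \<KK> \<Longrightarrow> e0 (\<Phi> 0 x) = \<phi> x" "\<And>x. x \<in> \<KK> \<Longrightarrow> e0 (\<Psi> 0 x) = \<psi> x"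
    using S(2) by (auto simp: above_def Si)
  obtain \<sigma> where \<sigma>: "\<sigma> \<in> extensional \<KK>" "\<And>x. x \<in> \<KK> \<Longrightarrow> \<sigma> x \<in> \<KK>"
      "\<And>i x. x \<in> \<KK> \<Longrightarrow> \<Phi> i (\<sigma> x) = \<Psi> i x"
      "\<And>D \<theta>. D \<in> Obj C \<Longrightarrow> \<theta> \<in> E\<^sub>\<KK> D \<Longrightarrow> compose \<KK> \<theta> \<sigma> \<in> E\<^sub>\<KK> D"
    using thread_map[of D \<Phi> \<Psi> e s, OF D e s] by blast
  obtain \<tau> where \<tau>: "\<tau> \<in> extensional \<KK>" "\<And>x. x \<in> \<KK> \<Longrightarrow> \<tau> x \<in> \<KK>"
      "\<And>i x. x \<in> \<KK> \<Longrightarrow> \<Psi> i (\<tau> x) = \<Phi> i x"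
      "\<And>D \<theta>. D \<in> Obj C \<Longrightarrow> \<theta> \<in> E\<^sub>\<KK> D \<Longrightarrow> compose \<KK> \<theta> \<tau> \<in> E\<^sub>\<KK> D"
    using thread_map[of D \<Psi> \<Phi> e t, OF D(1,3,2) e(2,1) t] by blast
  \<comment> \<open>\<open>t i\<close> recovers coordinate \<open>i\<close> from the value of
    \<open>\<Psi> i\<close>, and at \<open>\<tau> (\<sigma> x)\<close> this value is
    \<open>\<Phi> i (\<sigma> x) = \<Psi> i x\<close>.\<close>
  have "\<tau> (\<sigma> x) = x" if x: "x \<in> \<KK>" for x
  proof
    fix i
    show "\<tau> (\<sigma> x) i = x i"
      using t(2)[OF \<tau>(2)[OF \<sigma>(2)[OF x]], of i] t(2)[OF x, of i] \<tau>(3)[OF \<sigma>(2)[OF x], of i]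
        \<sigma>(3)[OF x, of i] by simp
  qed
  moreover have "\<sigma> (\<tau> x) = x" if x: "x \<in> \<KK>" for x
  proof
    fix i
    show "\<sigma> (\<tau> x) i = x i"
      using s(2)[OF \<sigma>(2)[OF \<tau>(2)[OF x]], of i] s(2)[OF x, of i] \<sigma>(3)[OF \<tau>(2)[OF x], of i]
        \<tau>(3)[OF x, of i] by simp
  qed
  ultimately have "\<sigma> \<in> aut C A p"
    using \<sigma> \<tau> by (intro autI[where \<tau> = \<tau>]) auto
  moreover have "\<phi> (\<sigma> x) = \<psi> x" if "x \<in> \<KK>" for x
    using that e0 \<sigma>(2,3) by metis
  ultimately show ?thesis using that by blast
qed

subsection \<open>Conjugating a realization of a tuple\<close>

abbreviation conj_aut :: "((nat \<Rightarrow> 'v) \<Rightarrow> (nat \<Rightarrow> 'v)) \<Rightarrow> ((nat \<Rightarrow> 'v) \<Rightarrow> (nat \<Rightarrow> 'v)) \<Rightarrow>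
    (nat \<Rightarrow> 'v) \<Rightarrow> (nat \<Rightarrow> 'v)" where
  "conj_aut h \<sigma> \<equiv> compose \<KK> h (compose \<KK> \<sigma> (map_inv \<KK> h))"

definition eq_at :: "nat \<Rightarrow> ((nat \<Rightarrow> 'v) \<Rightarrow> (nat \<Rightarrow> 'v)) \<Rightarrow> ((nat \<Rightarrow> 'v) \<Rightarrow> (nat \<Rightarrow> 'v)) \<Rightarrow> bool" where
  "eq_at m \<sigma> \<tau> \<longleftrightarrow> (\<forall>x\<in>\<KK>. \<sigma> x m = \<tau> x m)"

definition rel_at :: "nat \<Rightarrow> ((nat \<Rightarrow> 'v) \<Rightarrow> (nat \<Rightarrow> 'v)) \<Rightarrow> ((nat \<Rightarrow> 'v) \<Rightarrow> (nat \<Rightarrow> 'v)) \<Rightarrow> bool" where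
  "rel_at m \<sigma> \<tau> \<longleftrightarrow> (\<forall>x\<in>\<KK>. (\<sigma> x m, \<tau> x m) \<in> rel (A m))"

text \<open>The tuple is read as a finite approximation of automorphisms: \<open>\<sigma> j\<close>
  carries each fibre of \<open>f j \<circ> \<phi>\<close> onto the fibre of
  \<open>g j \<circ> \<phi>\<close> over the same vertex.\<close>

definition realizes :: "nat \<Rightarrow> 'v partial_tuple \<Rightarrow> ((nat \<Rightarrow> 'v) \<Rightarrow> 'v) \<Rightarrow>
    (nat \<Rightarrow> (nat \<Rightarrow> 'v) \<Rightarrow> (nat \<Rightarrow> 'v)) \<Rightarrow> bool" where
  "realizes n Y \<phi> \<sigma> \<longleftrightarrow> (case Y of (B, D, f, g) \<Rightarrow> \<phi> \<in> E\<^sub>\<KK> B \<and>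
     (\<forall>j<n. \<sigma> j \<in> aut C A p \<and> (\<forall>x\<in>\<KK>. f j (\<phi> x) = g j (\<phi> (\<sigma> j x)))))"

text \<open>\<open>G\<close> is \<open>tuple_epis C n\<close> or \<open>approx_tuple_epis C n\<close>, and \<open>Q\<close> the matching closeness relation
  \<open>eq_at m\<close> or \<open>rel_at m\<close>.\<close>

definition controls :: "nat \<Rightarrow> ('v partial_tuple \<Rightarrow> 'v partial_tuple \<Rightarrow> ('v \<Rightarrow> 'v) set) \<Rightarrow>
    (((nat \<Rightarrow> 'v) \<Rightarrow> (nat \<Rightarrow> 'v)) \<Rightarrow> ((nat \<Rightarrow> 'v) \<Rightarrow> (nat \<Rightarrow> 'v)) \<Rightarrow> bool) \<Rightarrow>
    (nat \<Rightarrow> (nat \<Rightarrow> 'v) \<Rightarrow> (nat \<Rightarrow> 'v)) \<Rightarrow> 'v partial_tuple \<Rightarrow> bool" where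
  "controls n G Q u X \<longleftrightarrow> (\<forall>Y\<in>partial_tuples C n. \<forall>\<phi> \<sigma>. realizes n Y \<phi> \<sigma> \<longrightarrow> G Y X \<noteq> {} \<longrightarrow>
     (\<exists>h\<in>aut C A p. \<forall>j<n. Q (u j) (conj_aut h (\<sigma> j))))"

text \<open>\<open>f j \<circ> \<phi>\<close> and \<open>g j \<circ> \<phi>\<close> are epimorphisms
  onto the same object, so homogeneity supplies \<open>\<sigma> j\<close> separately for each
  \<open>j\<close>.\<close>

lemma realizable:
  assumes "Y \<in> partial_tuples C n"
  shows "\<exists>\<phi> \<sigma>. realizes n Y \<phi> \<sigma>"
proof -
  obtain B D f g where Y: "Y = (B, D, f, g)" and BD: "B \<in> Obj C" "D \<in> Obj C"
    and fg: "f \<in> {..<n} \<rightarrow>\<^sub>E Epi C B D" "g \<in> {..<n} \<rightarrow>\<^sub>E Epi C B D"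
    using assms unfolding partial_tuples_def by blast
  obtain \<phi> where \<phi>: "\<phi> \<in> E\<^sub>\<KK> B" using limit_epi_nonempty[OF BD(1)] by blast
  have "\<exists>\<sigma>. \<sigma> \<in> aut C A p \<and> (\<forall>x\<in>\<KK>. f j (\<phi> x) = g j (\<phi> (\<sigma> x)))" if "j < n" for j
  proof -
    have j: "f j \<in> Epi C B D" "g j \<in> Epi C B D"
      using fg \<open>j < n\<close> by (auto simp: PiE_iff)
    obtain \<sigma> where \<sigma>: "\<sigma> \<in> aut C A p"
      "\<And>x. x \<in> \<KK> \<Longrightarrow> compose \<KK> (g j) \<phi> (\<sigma> x) = compose \<KK> (f j) \<phi> x"
      using homogeneous[OF BD(2) limit_epi_compose[OF BD \<phi> j(2)] limit_epi_compose[OF BD \<phi> j(1)]]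
      by blast
    then have "\<forall>x\<in>\<KK>. f j (\<phi> x) = g j (\<phi> (\<sigma> x))" by (simp add: compose_eq aut_maps)
    with \<sigma>(1) show ?thesis by blast
  qed
  then obtain \<sigma> where "\<forall>j<n. \<sigma> j \<in> aut C A p \<and> (\<forall>x\<in>\<KK>. f j (\<phi> x) = g j (\<phi> (\<sigma> j x)))"
    by metis
  then show ?thesis using \<phi> unfolding realizes_def Y by auto
qed

text \<open>An automorphism turns the projection to \<open>A m\<close> into another epimorphism,
  which factors through all sufficiently high stages; finitely many automorphisms share such a
  stage.\<close>

lemma represent_tuple:
  assumes u: "\<And>j. j < n \<Longrightarrow> u j \<in> aut C A p"
  obtains k f g where "(A k, A m, f, g) \<in> partial_tuples C n"
    "\<And>j x. j < n \<Longrightarrow> x \<in> \<KK> \<Longrightarrow> f j (x k) = u j x m"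
    "\<And>j x. j < n \<Longrightarrow> x \<in> \<KK> \<Longrightarrow> g j (x k) = x m"
proof -
  have "\<exists>i. \<forall>k\<ge>i. \<exists>f\<in>Epi C (A k) (A m). \<forall>x\<in>\<KK>. f (x k) = u j x m" if j: "j < n" for j
  proof -
    have "compose \<KK> (\<lambda>x\<in>\<KK>. x m) (u j) \<in> E\<^sub>\<KK> (A m)"
      using aut_compose_epi(1)[OF u[OF j] Obj_A proj_limit_epi] .
    then obtain i where i: "\<And>k. i \<le> k \<Longrightarrow>
        \<exists>f\<in>Epi C (A k) (A m). compose \<KK> (\<lambda>x\<in>\<KK>. x m) (u j) = (\<lambda>x\<in>\<KK>. f (x k))"
      using limit_epi_eventually[OF Obj_A] by blast
    have "\<exists>f\<in>Epi C (A k) (A m). \<forall>x\<in>\<KK>. f (x k) = u j x m" if k: "i \<le> k" for k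
    proof -
      obtain f where f: "f \<in> Epi C (A k) (A m)"
          "compose \<KK> (\<lambda>x\<in>\<KK>. x m) (u j) = (\<lambda>x\<in>\<KK>. f (x k))"
        using i[OF k] by blast
      have "f (x k) = u j x m" if "x \<in> \<KK>" for x
        using fun_cong[OF f(2), of x] that aut_maps[OF u[OF j]] by (simp add: compose_eq)
      with f(1) show ?thesis by blast
    qed
    then show ?thesis by blast
  qed
  then have "\<forall>j\<in>{..<n}. \<exists>i. \<forall>k\<ge>i. \<exists>f\<in>Epi C (A k) (A m). \<forall>x\<in>\<KK>. f (x k) = u j x m"
    by simp
  from bchoice[OF this] obtain i where i: "\<And>j k. j < n \<Longrightarrow> i j \<le> k \<Longrightarrow>
      \<exists>f\<in>Epi C (A k) (A m). \<forall>x\<in>\<KK>. f (x k) = u j x m"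
    by auto
  \<comment> \<open>The sum bounds every \<open>i j\<close>, and the summand \<open>m\<close>
    ensures that the bonding map runs from \<open>A k\<close> to \<open>A m\<close>.\<close>
  define k where "k = m + (\<Sum>j<n. i j)"
  have "i j \<le> k" if "j < n" for j
    using member_le_sum[of j "{..<n}" i] that by (simp add: k_def)
  then have "\<forall>j\<in>{..<n}. \<exists>f. f \<in> Epi C (A k) (A m) \<and> (\<forall>x\<in>\<KK>. f (x k) = u j x m)"
    using i by blast
  from bchoice[OF this] obtain f where f: "\<And>j. j < n \<Longrightarrow> f j \<in> Epi C (A k) (A m)"
      "\<And>j x. j < n \<Longrightarrow> x \<in> \<KK> \<Longrightarrow> f j (x k) = u j x m"
    by auto
  show ?thesis
  proof (rule that)
    have "bonding A p m k \<in> Epi C (A k) (A m)" by (rule bonding_Epi) (simp add: k_def)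
    then have "restrict f {..<n} \<in> {..<n} \<rightarrow>\<^sub>E Epi C (A k) (A m)"
        "(\<lambda>j\<in>{..<n}. bonding A p m k) \<in> {..<n} \<rightarrow>\<^sub>E Epi C (A k) (A m)"
      using f(1) by (simp_all add: restrict_PiE_iff)
    then show "(A k, A m, restrict f {..<n}, \<lambda>j\<in>{..<n}. bonding A p m k) \<in> partial_tuples C n"
      unfolding partial_tuples_def using Obj_A by blast
    show "restrict f {..<n} j (x k) = u j x m" if "j < n" "x \<in> \<KK>" for j x
      using that f(2) by simp
    show "(\<lambda>j\<in>{..<n}. bonding A p m k) j (x k) = x m" if "j < n" "x \<in> \<KK>" for j x
      using that bonding_limit[of x m k] by (simp add: k_def)
  qed
qed

text \<open>Homogeneity gives \<open>h\<close> whose projection to \<open>A k\<close> is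
  \<open>\<alpha> \<circ> \<phi>\<close>. With \<open>y\<close> the preimage of \<open>x\<close>
  under \<open>h\<close>, the \<open>m\<close>-th coordinates of \<open>u j x\<close> and of the
  conjugate at \<open>x\<close> are \<open>f j (\<alpha> (\<phi> y))\<close> and
  \<open>g j (\<alpha> (\<phi> (\<sigma> j y)))\<close>, the very vertices compared by the condition
  on \<open>\<alpha>\<close>.\<close>

lemma controlled:
  assumes u: "\<And>j. j < n \<Longrightarrow> u j \<in> aut C A p"
  obtains X where "X \<in> partial_tuples C n" "controls n (tuple_epis C n) (eq_at m) u X"
    "controls n (approx_tuple_epis C n) (rel_at m) u X"
proof -
  obtain k f g where X: "(A k, A m, f, g) \<in> partial_tuples C n"
    and f: "\<And>j x. j < n \<Longrightarrow> x \<in> \<KK> \<Longrightarrow> f j (x k) = u j x m"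
    and g: "\<And>j x. j < n \<Longrightarrow> x \<in> \<KK> \<Longrightarrow> g j (x k) = x m"
    using represent_tuple[of n u m, OF u] by blast
  \<comment> \<open>\<open>S\<close> will be \<open>Id\<close> for epimorphisms and
    \<open>rel (A m)\<close> for approximate ones, so one computation serves both.\<close>
  have conj: "\<exists>h\<in>aut C A p. \<forall>j<n. \<forall>x\<in>\<KK>. (u j x m, conj_aut h (\<sigma> j) x m) \<in> S"
    if BD: "B \<in> Obj C" "D \<in> Obj C" and \<alpha>: "\<alpha> \<in> Epi C B (A k)"
      and r: "realizes n (B, D, f', g') \<phi> \<sigma>"
      and S: "\<And>j a b. j < n \<Longrightarrow> a \<in> verts B \<Longrightarrow> b \<in> verts B \<Longrightarrow> f' j a = g' j b \<Longrightarrow>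
        (f j (\<alpha> a), g j (\<alpha> b)) \<in> S" for S B D f' g' \<phi> \<sigma> \<alpha>
  proof -
    have \<phi>: "\<phi> \<in> E\<^sub>\<KK> B" and \<sigma>: "\<And>j. j < n \<Longrightarrow> \<sigma> j \<in> aut C A p"
      and eq: "\<And>j x. j < n \<Longrightarrow> x \<in> \<KK> \<Longrightarrow> f' j (\<phi> x) = g' j (\<phi> (\<sigma> j x))"
      using r by (auto simp: realizes_def)
    obtain h where h: "h \<in> aut C A p"
        "\<And>x. x \<in> \<KK> \<Longrightarrow> (\<lambda>x\<in>\<KK>. x k) (h x) = compose \<KK> \<alpha> \<phi> x"
      using homogeneous[OF Obj_A proj_limit_epi limit_epi_compose[OF BD(1) Obj_A \<phi> \<alpha>]] by blast
    have hk: "h x k = \<alpha> (\<phi> x)" if "x \<in> \<KK>" for x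
      using h(2)[OF that] aut_maps[OF h(1) that] that by (simp add: compose_eq)
    have "(u j x m, conj_aut h (\<sigma> j) x m) \<in> S" if j: "j < n" and x: "x \<in> \<KK>" for j x
    proof -
      define y where "y = map_inv \<KK> h x"
      have y: "y \<in> \<KK>" and hy: "h y = x"
        using map_inv_maps[OF h(1) x] map_inv_right[OF h(1) x] by (simp_all add: y_def)
      have \<sigma>y: "\<sigma> j y \<in> \<KK>" using aut_maps[OF \<sigma>[OF j] y] .
      \<comment> \<open>Since \<open>\<sigma>\<close> realizes the tuple,
        \<open>f' j (\<phi> y) = g' j (\<phi> (\<sigma> j y))\<close>, which is the premise of the
        condition on \<open>\<alpha>\<close>.\<close>
      have "(f j (\<alpha> (\<phi> y)), g j (\<alpha> (\<phi> (\<sigma> j y)))) \<in> S"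
        using S[OF j limit_epi_maps[OF BD(1) \<phi> y] limit_epi_maps[OF BD(1) \<phi> \<sigma>y] eq[OF j y]] .
      moreover have "f j (\<alpha> (\<phi> y)) = u j x m"
        using f[OF j x] hk[OF y] hy by simp
      moreover have "g j (\<alpha> (\<phi> (\<sigma> j y))) = h (\<sigma> j y) m"
        using g[OF j aut_maps[OF h(1) \<sigma>y]] hk[OF \<sigma>y] by simp
      moreover have "conj_aut h (\<sigma> j) x = h (\<sigma> j y)"
        using x by (simp add: compose_eq y_def)
      ultimately show ?thesis by simp
    qed
    with h(1) show ?thesis by blast
  qed
  show ?thesis
  proof (rule that[OF X])
    show "controls n (tuple_epis C n) (eq_at m) u (A k, A m, f, g)"
      unfolding controls_def
    proof (intro ballI allI impI)
      fix Y \<phi> \<sigma>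
      assume Y: "Y \<in> partial_tuples C n" "realizes n Y \<phi> \<sigma>" "tuple_epis C n Y (A k, A m, f, g) \<noteq> {}"
      obtain B D f' g' where BD: "Y = (B, D, f', g')" "B \<in> Obj C" "D \<in> Obj C"
        using Y(1) unfolding partial_tuples_def by blast
      obtain \<alpha> where \<alpha>: "\<alpha> \<in> Epi C B (A k)" "\<And>j a b. j < n \<Longrightarrow> a \<in> verts B \<Longrightarrow> b \<in> verts B \<Longrightarrow>
          f' j a = g' j b \<Longrightarrow> f j (\<alpha> a) = g j (\<alpha> b)"
        using Y(3) unfolding BD(1) tuple_epis.simps by blast
      have "\<exists>h\<in>aut C A p. \<forall>j<n. \<forall>x\<in>\<KK>. (u j x m, conj_aut h (\<sigma> j) x m) \<in> Id"
        by (rule conj[OF BD(2,3) \<alpha>(1) Y(2)[unfolded BD(1)]]) (use \<alpha>(2) in blast)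
      then show "\<exists>h\<in>aut C A p. \<forall>j<n. eq_at m (u j) (conj_aut h (\<sigma> j))"
        by (simp only: eq_at_def pair_in_Id_conv)
    qed
    show "controls n (approx_tuple_epis C n) (rel_at m) u (A k, A m, f, g)"
      unfolding controls_def
    proof (intro ballI allI impI)
      fix Y \<phi> \<sigma>
      assume Y: "Y \<in> partial_tuples C n" "realizes n Y \<phi> \<sigma>"
        "approx_tuple_epis C n Y (A k, A m, f, g) \<noteq> {}"
      obtain B D f' g' where BD: "Y = (B, D, f', g')" "B \<in> Obj C" "D \<in> Obj C"
        using Y(1) unfolding partial_tuples_def by blast
      obtain \<alpha> where \<alpha>: "\<alpha> \<in> Epi C B (A k)" "\<And>j a b. j < n \<Longrightarrow> a \<in> verts B \<Longrightarrow> b \<in> verts B \<Longrightarrow>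
          f' j a = g' j b \<Longrightarrow> (f j (\<alpha> a), g j (\<alpha> b)) \<in> rel (A m)"
        using Y(3) unfolding BD(1) approx_tuple_epis.simps by blast
      show "\<exists>h\<in>aut C A p. \<forall>j<n. rel_at m (u j) (conj_aut h (\<sigma> j))"
        unfolding rel_at_def
        by (rule conj[OF BD(2,3) \<alpha>(1) Y(2)[unfolded BD(1)]]) (use \<alpha>(2) in blast)
    qed
  qed
qed

lemma aut_conj: "h \<in> aut C A p \<Longrightarrow> \<sigma> \<in> aut C A p \<Longrightarrow> conj_aut h \<sigma> \<in> aut C A p"
  by (intro aut_compose aut_map_inv)

text \<open>Controlling one realization in two ways produces two conjugators \<open>h\<close> and
  \<open>h'\<close>; passing from one conjugate to the other by \<open>h' h^-1\<close> places both
  in one orbit.\<close>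

lemma conj_aut_conj_aut:
  assumes h: "h \<in> aut C A p" and h': "h' \<in> aut C A p" and \<sigma>: "\<sigma> \<in> aut C A p"
  shows "conj_aut (compose \<KK> h' (map_inv \<KK> h)) (conj_aut h \<sigma>) = conj_aut h' \<sigma>"
proof -
  let ?g = "compose \<KK> h' (map_inv \<KK> h)"
  have g: "?g \<in> aut C A p" using assms by (intro aut_compose aut_map_inv)
  have inv: "map_inv \<KK> ?g x = h (map_inv \<KK> h' x)" if x: "x \<in> \<KK>" for x
  proof -
    have y: "map_inv \<KK> h' x \<in> \<KK>" using map_inv_maps[OF h' x] .
    have "?g (h (map_inv \<KK> h' x)) = x"
      using aut_maps[OF h y] map_inv_left[OF h y] map_inv_right[OF h' x] by (simp add: compose_eq)
    then show ?thesis using map_inv_left[OF g aut_maps[OF h y]] by simp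
  qed
  show ?thesis
  proof
    fix x
    show "conj_aut ?g (conj_aut h \<sigma>) x = conj_aut h' \<sigma> x"
    proof (cases "x \<in> \<KK>")
      case True
      then show ?thesis
        by (simp add: compose_eq inv map_inv_maps map_inv_left aut_maps assms)
    qed (simp add: compose_def)
  qed
qed

text \<open>One realization of the joint tuple \<open>Y\<close> is conjugated once towards
  \<open>v\<close> and once towards \<open>u\<close>. Keeping \<open>G\<close>, \<open>G'\<close>,
  \<open>Q\<close> and \<open>Q'\<close> arbitrary covers all three joint projection
  properties.\<close>

lemma joint_conjugates:
  assumes JP: "\<And>X X'. X \<in> partial_tuples C n \<Longrightarrow> X' \<in> partial_tuples C n \<Longrightarrow>
      \<exists>Y\<in>partial_tuples C n. G Y X \<noteq> {} \<and> G' Y X' \<noteq> {}"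
    and X: "X \<in> partial_tuples C n" "controls n G Q v X"
    and X': "X' \<in> partial_tuples C n" "controls n G' Q' u X'"
  shows "\<exists>\<gamma>\<in>{..<n} \<rightarrow>\<^sub>E aut C A p. \<exists>\<delta>\<in>{..<n} \<rightarrow>\<^sub>E aut C A p. \<delta> \<in> conj_orbit C A p n \<gamma> \<and>
    (\<forall>j<n. Q (v j) (\<gamma> j)) \<and> (\<forall>j<n. Q' (u j) (\<delta> j))"
proof -
  obtain Y where Y: "Y \<in> partial_tuples C n" "G Y X \<noteq> {}" "G' Y X' \<noteq> {}"
    using JP[OF X(1) X'(1)] by blast
  obtain \<phi> \<sigma> where r: "realizes n Y \<phi> \<sigma>" using realizable[OF Y(1)] by blast
  obtain h where h: "h \<in> aut C A p" "\<And>j. j < n \<Longrightarrow> Q (v j) (conj_aut h (\<sigma> j))"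
    using X(2) Y r unfolding controls_def by blast
  obtain h' where h': "h' \<in> aut C A p" "\<And>j. j < n \<Longrightarrow> Q' (u j) (conj_aut h' (\<sigma> j))"
    using X'(2) Y r unfolding controls_def by blast
  have \<sigma>: "\<sigma> j \<in> aut C A p" if "j < n" for j
    using r that by (auto simp: realizes_def split: prod.splits)
  let ?g = "compose \<KK> h' (map_inv \<KK> h)"
  let ?\<gamma> = "\<lambda>j\<in>{..<n}. conj_aut h (\<sigma> j)"
  let ?\<delta> = "\<lambda>j\<in>{..<n}. conj_aut h' (\<sigma> j)"
  have "?g \<in> aut C A p" using h h' by (intro aut_compose aut_map_inv)
  moreover have "?\<delta> = (\<lambda>j\<in>{..<n}. conj_aut ?g (?\<gamma> j))"
    using conj_aut_conj_aut[OF h(1) h'(1) \<sigma>] by (auto simp: restrict_def fun_eq_iff)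
  ultimately have "?\<delta> \<in> conj_orbit C A p n ?\<gamma>"
    unfolding conj_orbit_def by blast
  moreover have "?\<gamma> \<in> {..<n} \<rightarrow>\<^sub>E aut C A p" "?\<delta> \<in> {..<n} \<rightarrow>\<^sub>E aut C A p"
    using aut_conj[OF h(1) \<sigma>] aut_conj[OF h'(1) \<sigma>] by (simp_all add: restrict_PiE_iff)
  ultimately show ?thesis
    using h(2) h'(2) by (intro bexI[of _ ?\<gamma>] bexI[of _ ?\<delta>]) simp_all
qed

subsection \<open>Neighbourhoods in the automorphism and homeomorphism groups\<close>

text \<open>The coherence equations of threads cut out a closed subset of a product of finite
  discrete spaces, which is compact.\<close>

lemma compact_limit_space: "compact_space (limit_space A p)"
proof -
  let ?X = "product_topology (\<lambda>m. discrete_topology (verts (A m))) UNIV"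
  have "compact_space ?X"
    by (simp add: compact_space_product_topology compact_space_discrete_topology Obj_finite)
  moreover have "closedin ?X \<KK>"
  proof -
    have "closedin ?X {x \<in> topspace ?X. (p m \<circ> (\<lambda>x. x (Suc m))) x = x m}" for m
    proof (rule closedin_continuous_maps_eq[of "discrete_topology (verts (A m))"])
      show "continuous_map ?X (discrete_topology (verts (A m))) (p m \<circ> (\<lambda>x. x (Suc m)))"
        by (rule continuous_map_compose[OF continuous_map_product_projection])
          (auto intro: Epi_maps[OF Epi_p])
    qed (auto intro: continuous_map_product_projection simp: Hausdorff_space_discrete_topology)
    then have "closedin ?X (\<Inter>m. {x \<in> topspace ?X. (p m \<circ> (\<lambda>x. x (Suc m))) x = x m})"
      by blast
    moreover have "(\<Inter>m. {x \<in> topspace ?X. (p m \<circ> (\<lambda>x. x (Suc m))) x = x m}) = \<KK>"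
      by (auto simp: limit_points_def)
    ultimately show ?thesis by simp
  qed
  ultimately show ?thesis
    unfolding limit_space_def
    by (simp add: closedin_compact_space compact_space_subtopology)
qed

text \<open>If every level had a bad pair, the bad pairs would form a decreasing sequence of
  non-empty closed sets; a common point would satisfy \<open>S\<close> at all levels and still avoid
  \<open>W\<close>.\<close>

lemma compact_entourage:
  assumes W: "openin (prod_topology (limit_space A p) (limit_space A p)) W"
    and dec: "\<And>m x y. x \<in> \<KK> \<Longrightarrow> y \<in> \<KK> \<Longrightarrow> (x (Suc m), y (Suc m)) \<in> S (Suc m) \<Longrightarrow>
      (x m, y m) \<in> S m"
    and sub: "\<And>x y. x \<in> \<KK> \<Longrightarrow> y \<in> \<KK> \<Longrightarrow> (\<And>m. (x m, y m) \<in> S m) \<Longrightarrow> (x, y) \<in> W"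
  shows "\<exists>m. \<forall>x\<in>\<KK>. \<forall>y\<in>\<KK>. (x m, y m) \<in> S m \<longrightarrow> (x, y) \<in> W"
proof (rule ccontr)
  assume none: "\<not> ?thesis"
  let ?X = "limit_space A p"
  define F where "F m = {z \<in> \<KK> \<times> \<KK>. (fst z m, snd z m) \<in> S m} - W" for m
  have "(\<Inter>m. F m) \<noteq> {}"
  proof (rule compact_space_imp_nest)
    show "compact_space (prod_topology ?X ?X)"
      by (simp add: compact_space_prod_topology compact_limit_space)
    fix m
    have "continuous_map (prod_topology ?X ?X)
        (prod_topology (discrete_topology (verts (A m))) (discrete_topology (verts (A m))))
        (\<lambda>z. (fst z m, snd z m))"
      using continuous_map_compose[OF continuous_map_fst continuous_proj]
        continuous_map_compose[OF continuous_map_snd continuous_proj]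
      by (intro continuous_map_pairedI) (simp_all add: o_def)
    \<comment> \<open>Intersecting with the vertices turns \<open>S m\<close> into a subset of a
      discrete space, closed whatever \<open>S m\<close> is.\<close>
    then have "closedin (prod_topology ?X ?X)
        {z \<in> topspace (prod_topology ?X ?X). (fst z m, snd z m) \<in> S m \<inter> verts (A m) \<times> verts (A m)}"
      by (rule closedin_continuous_map_preimage) (simp flip: prod_topology_discrete_topology)
    moreover have "F m = {z \<in> topspace (prod_topology ?X ?X).
        (fst z m, snd z m) \<in> S m \<inter> verts (A m) \<times> verts (A m)} - W"
      by (auto simp: F_def limit_mem)
    ultimately show "closedin (prod_topology ?X ?X) (F m)" using W by (simp add: closedin_diff)
    show "F m \<noteq> {}"
      using none unfolding F_def by fastforce
  next
    show "decseq F"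
      unfolding decseq_Suc_iff F_def using dec by fastforce
  qed
  then show False using sub unfolding F_def by fastforce
qed

text \<open>Every epimorphism from the limit factors through a projection and morphisms preserve the
  relation, so the projections alone decide \<open>limit_rel\<close>.\<close>

lemma limit_rel_iff:
  assumes "x \<in> \<KK>" "y \<in> \<KK>"
  shows "(x, y) \<in> limit_rel C A p \<longleftrightarrow> (\<forall>m. (x m, y m) \<in> rel (A m))"
proof
  assume xy: "(x, y) \<in> limit_rel C A p"
  show "\<forall>m. (x m, y m) \<in> rel (A m)"
  proof
    fix m
    have "((\<lambda>x\<in>\<KK>. x m) x, (\<lambda>x\<in>\<KK>. x m) y) \<in> rel (A m)"
      using xy Obj_A proj_limit_epi unfolding limit_rel_def by blast
    then show "(x m, y m) \<in> rel (A m)" using assms by simp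
  qed
next
  assume r: "\<forall>m. (x m, y m) \<in> rel (A m)"
  have "(\<phi> x, \<phi> y) \<in> rel B" if B: "B \<in> Obj C" "\<phi> \<in> E\<^sub>\<KK> B" for B \<phi>
  proof -
    obtain k f where f: "f \<in> Epi C (A k) B" "\<phi> = (\<lambda>x\<in>\<KK>. f (x k))"
      using limit_epi_level[OF B] by blast
    then show ?thesis using Epi_rel[OF f(1) Obj_A B(1)] r assms by simp
  qed
  then show "(x, y) \<in> limit_rel C A p" using assms unfolding limit_rel_def by blast
qed

lemma topspace_aut_topology: "topspace (aut_topology C A p) = aut C A p"
  by (auto simp: aut_topology_def aut_def)

text \<open>Agreement in all coordinates is the diagonal, so by compactness agreement at one level
  already lies inside a given entourage.\<close>

lemma aut_nbhd:
  assumes U: "openin (aut_topology C A p) U" and u: "u \<in> U"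
  obtains m where "\<And>\<tau>. \<tau> \<in> aut C A p \<Longrightarrow> eq_at m u \<tau> \<Longrightarrow> \<tau> \<in> U"
proof -
  let ?X = "limit_space A p"
  obtain V where V: "openin (homeo_topology ?X) V" "U = V \<inter> aut C A p"
    using U unfolding aut_topology_def openin_subtopology by blast
  have uV: "u \<in> V" "u \<in> aut C A p" using u V(2) by auto
  obtain W where W: "openin (prod_topology ?X ?X) W" "\<And>x. x \<in> \<KK> \<Longrightarrow> (x, x) \<in> W"
    "{g \<in> homeos ?X. \<forall>x \<in> \<KK>. (u x, g x) \<in> W} \<subseteq> V"
    using V(1) uV(1) unfolding openin_homeo_topology topspace_limit_space by meson
  have "\<exists>m. \<forall>x\<in>\<KK>. \<forall>y\<in>\<KK>. (x m, y m) \<in> Id \<longrightarrow> (x, y) \<in> W"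
  proof (rule compact_entourage[OF W(1), of "\<lambda>_. Id"])
    show "(x m, y m) \<in> Id" if "x \<in> \<KK>" "y \<in> \<KK>" "(x (Suc m), y (Suc m)) \<in> Id" for m x y
      using limit_eq_mono[OF that(1,2), of m "Suc m"] that(3) by simp
    show "(x, y) \<in> W" if "x \<in> \<KK>" "y \<in> \<KK>" "\<And>m. (x m, y m) \<in> Id" for x y
    proof -
      have "x = y" using that(3) by (simp add: fun_eq_iff)
      then show ?thesis using W(2) that(1) by simp
    qed
  qed
  then obtain m where m: "\<forall>x\<in>\<KK>. \<forall>y\<in>\<KK>. (x m, y m) \<in> Id \<longrightarrow> (x, y) \<in> W" ..
  show ?thesis
  proof (rule that)
    fix \<tau> assume \<tau>: "\<tau> \<in> aut C A p" "eq_at m u \<tau>"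
    then have "\<forall>x\<in>\<KK>. (u x, \<tau> x) \<in> W"
      using m[rule_format, OF aut_maps[OF uV(2)] aut_maps[OF \<tau>(1)]] by (simp add: eq_at_def)
    moreover have "\<tau> \<in> homeos ?X" using \<tau>(1) by (simp add: aut_def)
    ultimately show "\<tau> \<in> U" using W(3) V(2) \<tau>(1) by blast
  qed
qed

text \<open>By transitivity related points have the same class, so an entourage of the quotient
  pulls back to an open set containing all of \<open>limit_rel\<close>. Compactness then finds a
  level whose graph relation forces membership in this set.\<close>

lemma homeo_nbhd:
  assumes t: "trans (limit_rel C A p)"
    and U: "openin (homeo_topology (quotient_space C A p)) U"
    and u: "u \<in> aut C A p" "pr_hom C A p u \<in> U"
  obtains m where "\<And>\<tau>. \<tau> \<in> aut C A p \<Longrightarrow> rel_at m u \<tau> \<Longrightarrow> pr_hom C A p \<tau> \<in> U"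
proof -
  let ?X = "limit_space A p" and ?Q = "quotient_space C A p"
  let ?pr = "\<lambda>x. limit_rel C A p `` {x}"
  obtain W where W: "openin (prod_topology ?Q ?Q) W" "\<And>c. c \<in> topspace ?Q \<Longrightarrow> (c, c) \<in> W"
    "{g \<in> homeos ?Q. \<forall>c \<in> topspace ?Q. (pr_hom C A p u c, g c) \<in> W} \<subseteq> U"
    using U u(2) unfolding openin_homeo_topology by meson
  have equiv: "equiv \<KK> (limit_rel C A p)"
    by (rule equiv_limit_rel[OF graph_category Obj_A t])
  have topQ: "topspace ?Q = \<KK> // limit_rel C A p" by (simp add: quotient_space_def)
  have pr: "continuous_map ?X ?Q ?pr"
    unfolding quotient_space_def
    by (intro quotient_imp_continuous_map quotient_map_quotient_topology)
  let ?W = "{z \<in> topspace (prod_topology ?X ?X). (?pr (fst z), ?pr (snd z)) \<in> W}"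
  have "continuous_map (prod_topology ?X ?X) (prod_topology ?Q ?Q)
      (\<lambda>z. (?pr (fst z), ?pr (snd z)))"
    using continuous_map_compose[OF continuous_map_fst pr]
      continuous_map_compose[OF continuous_map_snd pr]
    by (intro continuous_map_pairedI) (simp_all add: o_def)
  then have W': "openin (prod_topology ?X ?X) ?W"
    using W(1) by (rule openin_continuous_map_preimage)
  have "\<exists>m. \<forall>x\<in>\<KK>. \<forall>y\<in>\<KK>. (x m, y m) \<in> rel (A m) \<longrightarrow> (x, y) \<in> ?W"
  proof (rule compact_entourage[OF W', of "\<lambda>m. rel (A m)"])
    show "(x m, y m) \<in> rel (A m)"
      if "x \<in> \<KK>" "y \<in> \<KK>" "(x (Suc m), y (Suc m)) \<in> rel (A (Suc m))" for m x y
      using limit_rel_mono[OF that(1,2) _ that(3)] by simp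
    show "(x, y) \<in> ?W" if xy: "x \<in> \<KK>" "y \<in> \<KK>" "\<And>m. (x m, y m) \<in> rel (A m)" for x y
    proof -
      have "(x, y) \<in> limit_rel C A p" using xy by (simp add: limit_rel_iff)
      then have "?pr x = ?pr y" by (rule equiv_class_eq[OF equiv])
      then show ?thesis using W(2)[of "?pr y"] xy by (simp add: topQ quotientI)
    qed
  qed
  then obtain m where m: "\<forall>x\<in>\<KK>. \<forall>y\<in>\<KK>. (x m, y m) \<in> rel (A m) \<longrightarrow> (x, y) \<in> ?W" ..
  show ?thesis
  proof (rule that)
    fix \<tau> assume \<tau>: "\<tau> \<in> aut C A p" "rel_at m u \<tau>"
    have "(pr_hom C A p u c, pr_hom C A p \<tau> c) \<in> W" if c: "c \<in> topspace ?Q" for c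
    proof -
      obtain x where x: "x \<in> \<KK>" "c = ?pr x"
        using c unfolding topQ by (rule quotientE)
      then have "(u x, \<tau> x) \<in> ?W"
        using m[rule_format, OF aut_maps[OF u(1)] aut_maps[OF \<tau>(1)]] \<tau>(2) by (simp add: rel_at_def)
      then show ?thesis
        using pr_hom_apply[OF graph_category Obj_A t u(1) x(1)]
          pr_hom_apply[OF graph_category Obj_A t \<tau>(1) x(1)] x(2) by simp
    qed
    moreover have "pr_hom C A p \<tau> \<in> homeos ?Q"
      by (rule pr_hom_in_homeos[OF graph_category Obj_A t \<tau>(1)])
    ultimately show "pr_hom C A p \<tau> \<in> U" using W(3) by blast
  qed
qed

lemma eq_at_mono:
  assumes "eq_at k \<sigma> \<tau>" "m \<le> k" "\<sigma> \<in> aut C A p" "\<tau> \<in> aut C A p"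
  shows "eq_at m \<sigma> \<tau>"
  using assms limit_eq_mono[OF aut_maps aut_maps] unfolding eq_at_def by blast

lemma rel_at_mono:
  assumes "rel_at k \<sigma> \<tau>" "m \<le> k" "\<sigma> \<in> aut C A p" "\<tau> \<in> aut C A p"
  shows "rel_at m \<sigma> \<tau>"
  using assms limit_rel_mono[OF aut_maps aut_maps] unfolding rel_at_def by blast

end

section \<open>Approximating open sets in finite powers\<close>

text \<open>\<open>F\<close> will be \<open>pr_hom\<close> or the identity. Density moves a point of
  a basic box to the image of a tuple \<open>u\<close>, and monotonicity of \<open>Q\<close>
  replaces the levels found for the separate coordinates by a common one.\<close>

lemma power_nbhd:
  assumes dense: "T closure_of (F ` G) = topspace T"
    and nbhd: "\<And>U u. openin T U \<Longrightarrow> u \<in> G \<Longrightarrow> F u \<in> U \<Longrightarrow>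
      \<exists>m::nat. \<forall>\<tau>\<in>G. Q m u \<tau> \<longrightarrow> F \<tau> \<in> U"
    and mono: "\<And>m k \<sigma> \<tau>. Q k \<sigma> \<tau> \<Longrightarrow> m \<le> k \<Longrightarrow> \<sigma> \<in> G \<Longrightarrow> \<tau> \<in> G \<Longrightarrow> Q m \<sigma> \<tau>"
    and U: "openin (power_topology n T) U" "U \<noteq> {}"
  shows "\<exists>u m. (\<forall>j<n. u j \<in> G) \<and>
    (\<forall>\<tau>\<in>{..<n} \<rightarrow>\<^sub>E G. (\<forall>j<n. Q m (u j) (\<tau> j)) \<longrightarrow> (\<lambda>j\<in>{..<n}. F (\<tau> j)) \<in> U)"
proof -
  obtain w where "w \<in> U" using U(2) by blast
  then obtain V where V: "\<And>j. j < n \<Longrightarrow> openin T (V j)" "w \<in> Pi\<^sub>E {..<n} V" "Pi\<^sub>E {..<n} V \<subseteq> U"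
    using U(1) unfolding openin_product_topology_alt by (metis lessThan_iff)
  have "\<exists>u\<in>G. F u \<in> V j" if "j < n" for j
  proof -
    have "w j \<in> V j" using V(2) that by (auto simp: PiE_iff)
    then have "F ` G \<inter> V j \<noteq> {}"
      using dense V(1)[OF that] unfolding dense_intersects_open by blast
    then show ?thesis by blast
  qed
  then obtain u where u: "\<And>j. j < n \<Longrightarrow> u j \<in> G" "\<And>j. j < n \<Longrightarrow> F (u j) \<in> V j"
    by metis
  have "\<forall>j\<in>{..<n}. \<exists>m. \<forall>\<tau>\<in>G. Q m (u j) \<tau> \<longrightarrow> F \<tau> \<in> V j"
    using nbhd[OF V(1) u(1) u(2)] by simp
  from bchoice[OF this] obtain m where
    m: "\<And>j \<tau>. j < n \<Longrightarrow> \<tau> \<in> G \<Longrightarrow> Q (m j) (u j) \<tau> \<Longrightarrow> F \<tau> \<in> V j"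
    by auto
  show ?thesis
  proof (intro exI conjI allI impI ballI)
    show "u j \<in> G" if "j < n" for j using u(1)[OF that] .
    \<comment> \<open>The level witness is the sum of the \<open>m j\<close>, an upper bound for
      each of them that also makes sense for \<open>n = 0\<close>.\<close>
    fix \<tau> assume \<tau>: "\<tau> \<in> {..<n} \<rightarrow>\<^sub>E G" and "\<forall>j<n. Q (\<Sum>j<n. m j) (u j) (\<tau> j)"
    then have Q: "Q (\<Sum>j<n. m j) (u j) (\<tau> j)" if "j < n" for j using that by blast
    have "F (\<tau> j) \<in> V j" if j: "j < n" for j
    proof -
      have \<tau>j: "\<tau> j \<in> G" using \<tau> j by (auto simp: PiE_iff)
      have "m j \<le> (\<Sum>j<n. m j)" using j by (intro member_le_sum) auto
      then show ?thesis using m[OF j \<tau>j mono[OF Q[OF j] _ u(1)[OF j] \<tau>j]] by simp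
    qed
    then have "(\<lambda>j\<in>{..<n}. F (\<tau> j)) \<in> Pi\<^sub>E {..<n} V" by (simp add: restrict_PiE_iff)
    then show "(\<lambda>j\<in>{..<n}. F (\<tau> j)) \<in> U" using V(3) by blast
  qed
qed

section \<open>Density of the tuples with a conjugate in a given open set\<close>

theorem theorem3p4:
  fixes C :: "'v graph_class" and A :: "nat \<Rightarrow> 'v rgraph" and p :: "nat \<Rightarrow> 'v \<Rightarrow> 'v" and n :: nat
  assumes "projective_fraisse_class C"
    and "generic_sequence C A p"
    and "trans (limit_rel C A p)"
    and "homeo_topology (quotient_space C A p) closure_of (pr_hom C A p ` aut C A p) =
           homeos (quotient_space C A p)"
  shows
    "(approx_JPP C n \<longrightarrow>
       (\<forall>U. openin (power_topology n (homeo_topology (quotient_space C A p))) U \<and> U \<noteq> {} \<longrightarrow>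
          power_topology n (homeo_topology (quotient_space C A p)) closure_of
            (pr_tuple C A p n `
              {\<gamma> \<in> {..<n} \<rightarrow>\<^sub>E aut C A p. pr_tuple C A p n ` conj_orbit C A p n \<gamma> \<inter> U \<noteq> {}})
          = topspace (power_topology n (homeo_topology (quotient_space C A p))))) \<and>
     (half_approx_JPP C n \<longrightarrow>
       (\<forall>U. openin (power_topology n (homeo_topology (quotient_space C A p))) U \<and> U \<noteq> {} \<longrightarrow>
          power_topology n (aut_topology C A p) closure_of
            {\<gamma> \<in> {..<n} \<rightarrow>\<^sub>E aut C A p. pr_tuple C A p n ` conj_orbit C A p n \<gamma> \<inter> U \<noteq> {}}
          = topspace (power_topology n (aut_topology C A p)))) \<and>
     (JPP C n \<longrightarrow>
       (\<forall>U. openin (power_topology n (aut_topology C A p)) U \<and> U \<noteq> {} \<longrightarrow>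
          power_topology n (aut_topology C A p) closure_of
            {\<gamma> \<in> {..<n} \<rightarrow>\<^sub>E aut C A p. conj_orbit C A p n \<gamma> \<inter> U \<noteq> {}}
          = topspace (power_topology n (aut_topology C A p))))"
proof -
  interpret generic_limit C A p
    using assms(1,2) by unfold_locales
  let ?H = "homeo_topology (quotient_space C A p)" and ?G = "aut_topology C A p"
  \<comment> \<open>Density of the image of \<open>pr_hom\<close> places a tuple of automorphisms
    inside the open set; staying there is then guaranteed by closeness up to the graph relation at
    one level.\<close>
  have homeo: "\<exists>u m. (\<forall>j<n. u j \<in> aut C A p) \<and> (\<forall>\<tau>\<in>{..<n} \<rightarrow>\<^sub>E aut C A p.
      (\<forall>j<n. rel_at m (u j) (\<tau> j)) \<longrightarrow> pr_tuple C A p n \<tau> \<in> U)"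
    if U: "openin (power_topology n ?H) U" "U \<noteq> {}" for U
    unfolding pr_tuple_def
  proof (rule power_nbhd[OF _ _ rel_at_mono U])
    show "?H closure_of (pr_hom C A p ` aut C A p) = topspace ?H" using assms(4) by simp
    show "\<exists>m. \<forall>\<tau>\<in>aut C A p. rel_at m u \<tau> \<longrightarrow> pr_hom C A p \<tau> \<in> U"
      if "openin ?H U" "u \<in> aut C A p" "pr_hom C A p u \<in> U" for U u
      by (rule homeo_nbhd[OF assms(3) that]) blast
  qed
  have aut: "\<exists>u m. (\<forall>j<n. u j \<in> aut C A p) \<and> (\<forall>\<tau>\<in>{..<n} \<rightarrow>\<^sub>E aut C A p.
      (\<forall>j<n. eq_at m (u j) (\<tau> j)) \<longrightarrow> \<tau> \<in> U)"
    if U: "openin (power_topology n ?G) U" "U \<noteq> {}" for U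
  proof -
    have "\<exists>u m. (\<forall>j<n. u j \<in> aut C A p) \<and> (\<forall>\<tau>\<in>{..<n} \<rightarrow>\<^sub>E aut C A p.
        (\<forall>j<n. eq_at m (u j) (\<tau> j)) \<longrightarrow> (\<lambda>j\<in>{..<n}. id (\<tau> j)) \<in> U)"
    proof (rule power_nbhd[OF _ _ eq_at_mono U])
      \<comment> \<open>For the identity, the density premise says that the whole space is dense in
        itself.\<close>
      show "?G closure_of (id ` aut C A p) = topspace ?G"
        using closure_of_topspace[of ?G] by (simp add: topspace_aut_topology)
      show "\<exists>m. \<forall>\<tau>\<in>aut C A p. eq_at m u \<tau> \<longrightarrow> id \<tau> \<in> U"
        if "openin ?G U" "u \<in> aut C A p" "id u \<in> U" for U u
      proof (rule aut_nbhd[OF that(1)])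
        show "u \<in> U" using that(3) by simp
      qed auto
    qed
    then obtain u m where u: "\<forall>j<n. u j \<in> aut C A p" and
      U: "\<forall>\<tau>\<in>{..<n} \<rightarrow>\<^sub>E aut C A p. (\<forall>j<n. eq_at m (u j) (\<tau> j)) \<longrightarrow>
        (\<lambda>j\<in>{..<n}. id (\<tau> j)) \<in> U"
      by blast
    have "\<tau> \<in> U" if \<tau>: "\<tau> \<in> {..<n} \<rightarrow>\<^sub>E aut C A p" "\<forall>j<n. eq_at m (u j) (\<tau> j)" for \<tau>
      using U[rule_format, OF \<tau>(1) \<tau>(2)[rule_format]] PiE_restrict[OF \<tau>(1)] by simp
    with u show ?thesis by blast
  qed
  show ?thesis
    unfolding dense_intersects_open
  \<comment> \<open>Density is tested against a non-empty open \<open>V\<close>: the pair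
    \<open>v\<close>, \<open>X\<close> steers \<open>\<gamma>\<close> into \<open>V\<close>, and
    \<open>u\<close>, \<open>X'\<close> steer its conjugate \<open>\<delta>\<close> into
    \<open>U\<close>.\<close>
  proof (intro conjI impI allI; elim conjE)
    fix U V
    assume JP: "approx_JPP C n" and U: "openin (power_topology n ?H) U" "U \<noteq> {}"
      and V: "openin (power_topology n ?H) V" "V \<noteq> {}"
    obtain u m where u: "\<forall>j<n. u j \<in> aut C A p" "\<forall>\<tau>\<in>{..<n} \<rightarrow>\<^sub>E aut C A p.
        (\<forall>j<n. rel_at m (u j) (\<tau> j)) \<longrightarrow> pr_tuple C A p n \<tau> \<in> U"
      using homeo[OF U] by blast
    obtain v k where v: "\<forall>j<n. v j \<in> aut C A p" "\<forall>\<tau>\<in>{..<n} \<rightarrow>\<^sub>E aut C A p.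
        (\<forall>j<n. rel_at k (v j) (\<tau> j)) \<longrightarrow> pr_tuple C A p n \<tau> \<in> V"
      using homeo[OF V] by blast
    obtain X where X: "X \<in> partial_tuples C n" "controls n (approx_tuple_epis C n) (rel_at k) v X"
      by (rule controlled[OF v(1)[rule_format]])
    obtain X' where X': "X' \<in> partial_tuples C n" "controls n (approx_tuple_epis C n) (rel_at m) u X'"
      by (rule controlled[OF u(1)[rule_format]])
    obtain \<gamma> \<delta> where \<gamma>: "\<gamma> \<in> {..<n} \<rightarrow>\<^sub>E aut C A p" "\<delta> \<in> {..<n} \<rightarrow>\<^sub>E aut C A p"
      "\<delta> \<in> conj_orbit C A p n \<gamma>" "\<forall>j<n. rel_at k (v j) (\<gamma> j)"
      "\<forall>j<n. rel_at m (u j) (\<delta> j)"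
      using joint_conjugates[OF JP[unfolded approx_JPP_def, rule_format] X X'] by blast
    have "pr_tuple C A p n \<gamma> \<in> V" by (rule v(2)[rule_format, OF \<gamma>(1) \<gamma>(4)[rule_format]])
    moreover have "pr_tuple C A p n \<delta> \<in> U" by (rule u(2)[rule_format, OF \<gamma>(2) \<gamma>(5)[rule_format]])
    ultimately show "pr_tuple C A p n ` {\<gamma> \<in> {..<n} \<rightarrow>\<^sub>E aut C A p.
        pr_tuple C A p n ` conj_orbit C A p n \<gamma> \<inter> U \<noteq> {}} \<inter> V \<noteq> {}"
      using \<gamma>(1,3) by blast
  next
    fix U V
    assume JP: "half_approx_JPP C n" and U: "openin (power_topology n ?H) U" "U \<noteq> {}"
      and V: "openin (power_topology n ?G) V" "V \<noteq> {}"
    obtain u m where u: "\<forall>j<n. u j \<in> aut C A p" "\<forall>\<tau>\<in>{..<n} \<rightarrow>\<^sub>E aut C A p.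
        (\<forall>j<n. rel_at m (u j) (\<tau> j)) \<longrightarrow> pr_tuple C A p n \<tau> \<in> U"
      using homeo[OF U] by blast
    obtain v k where v: "\<forall>j<n. v j \<in> aut C A p" "\<forall>\<tau>\<in>{..<n} \<rightarrow>\<^sub>E aut C A p.
        (\<forall>j<n. eq_at k (v j) (\<tau> j)) \<longrightarrow> \<tau> \<in> V"
      using aut[OF V] by blast
    \<comment> \<open>The exact side of the half-approximate property goes to \<open>V\<close>,
      which is open in the power of the automorphism group; the approximate side suffices for
      \<open>U\<close>, which lives over the quotient.\<close>
    obtain X where X: "X \<in> partial_tuples C n" "controls n (tuple_epis C n) (eq_at k) v X"
      by (rule controlled[OF v(1)[rule_format]])
    obtain X' where X': "X' \<in> partial_tuples C n" "controls n (approx_tuple_epis C n) (rel_at m) u X'"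
      by (rule controlled[OF u(1)[rule_format]])
    obtain \<gamma> \<delta> where \<gamma>: "\<gamma> \<in> {..<n} \<rightarrow>\<^sub>E aut C A p" "\<delta> \<in> {..<n} \<rightarrow>\<^sub>E aut C A p"
      "\<delta> \<in> conj_orbit C A p n \<gamma>" "\<forall>j<n. eq_at k (v j) (\<gamma> j)"
      "\<forall>j<n. rel_at m (u j) (\<delta> j)"
      using joint_conjugates[OF JP[unfolded half_approx_JPP_def, rule_format] X X'] by blast
    have "\<gamma> \<in> V" by (rule v(2)[rule_format, OF \<gamma>(1) \<gamma>(4)[rule_format]])
    moreover have "pr_tuple C A p n \<delta> \<in> U" by (rule u(2)[rule_format, OF \<gamma>(2) \<gamma>(5)[rule_format]])
    ultimately show "{\<gamma> \<in> {..<n} \<rightarrow>\<^sub>E aut C A p.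
        pr_tuple C A p n ` conj_orbit C A p n \<gamma> \<inter> U \<noteq> {}} \<inter> V \<noteq> {}"
      using \<gamma>(1,3) by blast
  next
    fix U V
    assume JP: "JPP C n" and U: "openin (power_topology n ?G) U" "U \<noteq> {}"
      and V: "openin (power_topology n ?G) V" "V \<noteq> {}"
    obtain u m where u: "\<forall>j<n. u j \<in> aut C A p" "\<forall>\<tau>\<in>{..<n} \<rightarrow>\<^sub>E aut C A p.
        (\<forall>j<n. eq_at m (u j) (\<tau> j)) \<longrightarrow> \<tau> \<in> U"
      using aut[OF U] by blast
    obtain v k where v: "\<forall>j<n. v j \<in> aut C A p" "\<forall>\<tau>\<in>{..<n} \<rightarrow>\<^sub>E aut C A p.
        (\<forall>j<n. eq_at k (v j) (\<tau> j)) \<longrightarrow> \<tau> \<in> V"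
      using aut[OF V] by blast
    \<comment> \<open>Both open sets now lie in the power of the automorphism group, so both tuples
      are used with exact epimorphisms and equality of coordinates.\<close>
    obtain X where X: "X \<in> partial_tuples C n" "controls n (tuple_epis C n) (eq_at k) v X"
      by (rule controlled[OF v(1)[rule_format]])
    obtain X' where X': "X' \<in> partial_tuples C n" "controls n (tuple_epis C n) (eq_at m) u X'"
      by (rule controlled[OF u(1)[rule_format]])
    obtain \<gamma> \<delta> where \<gamma>: "\<gamma> \<in> {..<n} \<rightarrow>\<^sub>E aut C A p" "\<delta> \<in> {..<n} \<rightarrow>\<^sub>E aut C A p"
      "\<delta> \<in> conj_orbit C A p n \<gamma>" "\<forall>j<n. eq_at k (v j) (\<gamma> j)"
      "\<forall>j<n. eq_at m (u j) (\<delta> j)"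
      using joint_conjugates[OF JP[unfolded JPP_def, rule_format] X X'] by blast
    have "\<gamma> \<in> V" by (rule v(2)[rule_format, OF \<gamma>(1) \<gamma>(4)[rule_format]])
    moreover have "\<delta> \<in> U" by (rule u(2)[rule_format, OF \<gamma>(2) \<gamma>(5)[rule_format]])
    ultimately show "{\<gamma> \<in> {..<n} \<rightarrow>\<^sub>E aut C A p. conj_orbit C A p n \<gamma> \<inter> U \<noteq> {}} \<inter> V \<noteq> {}"
      using \<gamma>(1,3) by blast
  qed
qed

end
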